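(* For $n\ge1$ let $h_n$ be the number of (unlabeled) hereditary semiorders with $n$ points. Then the ordinary generating function $H(x)=\sum_{n\ge1}h_nx^n$ is $$H(x) = \frac{-x^5 + 9x^4 - 12x^3 + 6x^2 - x}{x^5 - 14x^4 + 29x^3 - 23x^2 + 8x-1}.$$
   Context: Unlabeled means counted up to isomorphism. All posets are finite and nonempty. A poset $P=(X,\le_P)$ is an interval order if each $x\in X$ can be assigned a closed bounded real interval $I(x)=[\ell(x),r(x)]$ so that $x<_P y$ iff $r(x)<\ell(y)$; it is a semiorder if this can be done with all intervals of the same length. Degenerate intervals $[i,i]$ are allowed, and distinct elements may get the same interval. Minimal endpoint representation: write $D(x)=\{y: y<_P x\}$, $U(x)=\{y: y>_P x\}$. In an interval order the distinct down sets form a chain $D_0\subsetneq\cdots\subsetneq D_{t-1}$ and the distinct up sets form a chain $U_0\supsetneq\cdots\supsetneq U_{t-1}$ (the same number $t$, a known fact). The minimal endpoint representation assigns to $x$ the interval $[i,j]$ where $D(x)=D_i$ and $U(x)=U_j$. Ascent sequences and $\Psi$: for an integer sequence, $\mathrm{asc}(x_1,\dots,x_i)=|\{1\le j<i: x_j<x_{j+1}\}|$. An ascent sequence is a sequence $(x_1,\dots,x_n)$ of nonnegative integers with $x_1=0$ and $x_i\in[0,1+\mathrm{asc}(x_1,\dots,x_{i-1})]$ for $2\le i\le n$. $\Psi$ is the bijection of Bousquet-Mélou et al. from unlabeled interval orders on $n$ points to ascent sequences of length $n$. Its inverse is given recursively (in terms of minimal endpoint representations, as multisets of intervals): $\Psi^{-1}((0))$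 has representation $\{[0,0]\}$. Given $Q=\Psi^{-1}((x_1,\dots,x_{n-1}))$, let $\ell(Q)$ be the largest right endpoint in its minimal endpoint representation (it is known that $\ell(Q)=\mathrm{asc}(x_1,\dots,x_{n-1})$) and $\ell^*(Q)$ the smallest left endpoint of an interval with right endpoint $\ell(Q)$. With $i=x_n$, the minimal endpoint representation of $\Psi^{-1}((x_1,\dots,x_n))$ is obtained by: (Move 1) if $i\le \ell^*(Q)$, add the interval $[i,\ell(Q)]$; (Move 2) if $i=\ell(Q)+1$, add $[\ell(Q)+1,\ell(Q)+1]$; (Move 3) if $\ell^*(Q)<i\le \ell(Q)$, simultaneously replace every $[\lambda,\rho]$ with $\lambda<i\le\rho<\ell(Q)$ by $[\lambda,\rho+1]$, every $[\lambda,\rho]$ with $i\le\lambda\le\rho\le \ell(Q)$ by $[\lambda+1,\rho+1]$, and every $[\lambda,\rho]$ with $\lambda<i$, $\rho=\ell(Q)$ by $[\lambda,i]$, and then add $[i,\ell(Q)+1]$. A semiorder $P$ on $n$ points with $\Psi(P)=(x_1,\dots,x_n)$ is hereditary if $\Psi^{-1}((x_1,\dots,x_i))$ is a semiorder for every $1\le i\le n$. *)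

theory Defs
  imports
    "HOL-Library.Multiset"
    "HOL-Computational_Algebra.Formal_Power_Series"
begin

subsection \<open>Posets, interval orders, semiorders\<close>

text \<open>A poset is a carrier \<open>X\<close> with a reflexive order relation \<open>r\<close> on it.\<close>

definition poset :: "'a set \<Rightarrow> 'a rel \<Rightarrow> bool" where
  "poset X r \<longleftrightarrow> finite X \<and> X \<noteq> {} \<and> partial_order_on X r"

definition strictly_below :: "'a rel \<Rightarrow> 'a \<Rightarrow> 'a \<Rightarrow> bool" where
  "strictly_below r x y \<longleftrightarrow> (x, y) \<in> r \<and> x \<noteq> y"

definition real_interval_rep :: "'a set \<Rightarrow> 'a rel \<Rightarrow> ('a \<Rightarrow> real) \<Rightarrow> ('a \<Rightarrow> real) \<Rightarrow> bool" where
  "real_interval_rep X r lft rgt \<longleftrightarrow>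
     (\<forall>x\<in>X. lft x \<le> rgt x) \<and>
     (\<forall>x\<in>X. \<forall>y\<in>X. strictly_below r x y \<longleftrightarrow> rgt x < lft y)"

definition interval_order :: "'a set \<Rightarrow> 'a rel \<Rightarrow> bool" where
  "interval_order X r \<longleftrightarrow> poset X r \<and> (\<exists>lft rgt. real_interval_rep X r lft rgt)"

definition semiorder :: "'a set \<Rightarrow> 'a rel \<Rightarrow> bool" where
  "semiorder X r \<longleftrightarrow> poset X r \<and>
     (\<exists>lft rgt c. real_interval_rep X r lft rgt \<and> (\<forall>x\<in>X. rgt x - lft x = c))"

definition poset_iso :: "'a set \<Rightarrow> 'a rel \<Rightarrow> 'b set \<Rightarrow> 'b rel \<Rightarrow> bool" where
  "poset_iso X r Y s \<longleftrightarrow>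
     (\<exists>f. bij_betw f X Y \<and> (\<forall>x\<in>X. \<forall>y\<in>X. (x, y) \<in> r \<longleftrightarrow> (f x, f y) \<in> s))"

subsection \<open>Minimal endpoint representations\<close>

definition down_set :: "'a set \<Rightarrow> 'a rel \<Rightarrow> 'a \<Rightarrow> 'a set" where
  "down_set X r x = {y\<in>X. strictly_below r y x}"

definition up_set :: "'a set \<Rightarrow> 'a rel \<Rightarrow> 'a \<Rightarrow> 'a set" where
  "up_set X r x = {y\<in>X. strictly_below r x y}"

text \<open>\<open>D 0, \<dots>, D (t - 1)\<close> is the strictly increasing enumeration of the distinct down sets and
  \<open>U 0, \<dots>, U (t - 1)\<close> the strictly decreasing one of the distinct up sets, both with the same
  number \<open>t\<close>; the pair \<open>(i, j)\<close> encodes the interval \<open>[i,j]\<close>.\<close>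

definition minimal_endpoint_rep :: "'a set \<Rightarrow> 'a rel \<Rightarrow> ('a \<Rightarrow> nat \<times> nat) \<Rightarrow> bool" where
  "minimal_endpoint_rep X r I \<longleftrightarrow>
     (\<exists>t D U.
        down_set X r ` X = D ` {..<t} \<and> strict_mono_on {..<t} D \<and>
        up_set X r ` X = U ` {..<t} \<and> strict_antimono_on {..<t} U \<and>
        (\<forall>x\<in>X. fst (I x) < t \<and> snd (I x) < t \<and>
                down_set X r x = D (fst (I x)) \<and> up_set X r x = U (snd (I x))))"

subsection \<open>Ascent sequences and the bijection\<close>

definition asc :: "nat list \<Rightarrow> nat" where
  "asc xs = card {j. Suc j < length xs \<and> xs ! j < xs ! Suc j}"

text \<open>Lists are indexed from 0, so \<open>xs ! i\<close> is the entry following the prefix \<open>take i xs\<close>.\<close>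

definition ascent_sequence :: "nat list \<Rightarrow> bool" where
  "ascent_sequence xs \<longleftrightarrow> xs \<noteq> [] \<and> xs ! 0 = 0 \<and>
     (\<forall>i\<in>{1..<length xs}. xs ! i \<le> 1 + asc (take i xs))"

definition max_right :: "(nat \<times> nat) multiset \<Rightarrow> nat" where
  "max_right M = Max (snd ` set_mset M)"

definition min_left_of_max_right :: "(nat \<times> nat) multiset \<Rightarrow> nat" where
  "min_left_of_max_right M = Min {a. (a, max_right M) \<in># M}"

definition move3_shift :: "nat \<Rightarrow> nat \<Rightarrow> nat \<times> nat \<Rightarrow> nat \<times> nat" where
  "move3_shift i L = (\<lambda>(a, b).
     if a < i \<and> i \<le> b \<and> b < L then (a, b + 1)
     else if i \<le> a \<and> a \<le> b \<and> b \<le> L then (a + 1, b + 1)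
     else if a < i \<and> b = L then (a, i)
     else (a, b))"

text \<open>The branches are Moves 1, 3 and 2; along an ascent sequence \<open>i \<le> max_right M + 1\<close>, so in the
  last branch \<open>i = max_right M + 1\<close>.\<close>

definition insert_interval :: "(nat \<times> nat) multiset \<Rightarrow> nat \<Rightarrow> (nat \<times> nat) multiset" where
  "insert_interval M i =
     (let L = max_right M in
      if i \<le> min_left_of_max_right M then add_mset (i, L) M
      else if i \<le> L then add_mset (i, L + 1) (image_mset (move3_shift i L) M)
      else add_mset (L + 1, L + 1) M)"

definition Psi_inv_rep :: "nat list \<Rightarrow> (nat \<times> nat) multiset" where
  "Psi_inv_rep xs = foldl insert_interval {#(0, 0)#} (tl xs)"

text \<open>\<open>Psi_eq X r xs\<close> expresses \<open>\<Psi>(X, r) = xs\<close>, equivalently that \<open>(X, r)\<close> is a representative of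
  the unlabeled interval order \<open>\<Psi>\<inverse>(xs)\<close>.\<close>

definition Psi_eq :: "'a set \<Rightarrow> 'a rel \<Rightarrow> nat list \<Rightarrow> bool" where
  "Psi_eq X r xs \<longleftrightarrow> interval_order X r \<and> ascent_sequence xs \<and> length xs = card X \<and>
     (\<exists>I. minimal_endpoint_rep X r I \<and> image_mset I (mset_set X) = Psi_inv_rep xs)"

text \<open>Being a semiorder is invariant under isomorphism, so the class \<open>\<Psi>\<inverse>(x\<^sub>1, \<dots>, x\<^sub>i)\<close> is tested
  on a representative with carrier \<open>{..<i}\<close>.\<close>

definition hereditary_semiorder :: "'a set \<Rightarrow> 'a rel \<Rightarrow> bool" where
  "hereditary_semiorder X r \<longleftrightarrow> semiorder X r \<and>
     (\<exists>xs. Psi_eq X r xs \<and>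
        (\<forall>i\<in>{1..card X}. \<exists>s :: nat rel. Psi_eq {..<i} s (take i xs) \<and> semiorder {..<i} s))"

text \<open>Unlabeled counting: isomorphism classes of structures with carrier \<open>{..<n}\<close>.\<close>

definition poset_iso_rel :: "nat \<Rightarrow> (nat rel) rel" where
  "poset_iso_rel n =
     {(r, s). poset {..<n} r \<and> poset {..<n} s \<and> poset_iso {..<n} r {..<n} s}"

definition num_hereditary :: "nat \<Rightarrow> nat" where
  "num_hereditary n = card ({r. hereditary_semiorder {..<n} r} // poset_iso_rel n)"

end

theory Submission
  imports Defs
begin

text \<open>
  The proof turns the count into a count of walks in a small automaton.

  \<^bold>\<open>From posets to sequences.\<close> A poset is recovered from a minimal endpoint representation: \<open>x\<close> is
  below \<open>y\<close> iff the interval of \<open>x\<close> ends before that of \<open>y\<close> starts (\<open>strictly_below_iff_endpoints\<close>). Hence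
  posets with such representations are isomorphic iff their multisets of intervals agree. Each step of
  \<open>\<Psi>\<inverse>\<close> can be undone (\<open>insert_interval_inject\<close>), so different ascent sequences give
  different multisets. An interval order is a semiorder iff in its minimal endpoint representation no
  interval lies in the interior of another (\<open>semiorder_iff_unnested\<close>). Therefore \<open>h\<^sub>n\<close> counts the ascent
  sequences of length \<open>n\<close> all of whose nonempty prefixes have an unnested representation
  (\<open>num_hereditary_eq_card_sequences\<close>).

  \<^bold>\<open>The automaton.\<close> In an unnested representation with largest right endpoint \<open>L > 0\<close>, let \<open>l\<close> be the
  smallest left endpoint of an interval ending at \<open>L\<close>, and \<open>m\<close> the largest left endpoint of an interval
  ending before \<open>L\<close>; then \<open>m\<close> is \<open>l\<close> or \<open>l - 1\<close>. The next entries that keep the representation unnested are \<open>l\<close>,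
  \<open>m\<close> and \<open>L + 1\<close>, moreover \<open>L\<close> if \<open>l < L\<close>, and \<open>l + 1\<close> if \<open>l + 1 < L\<close>, \<open>m = l\<close> and all intervals whose right
  endpoint is strictly between \<open>m\<close> and \<open>L\<close> start at \<open>m\<close> (\<open>legal_entries_profile\<close>). The triple consisting of
  \<open>L - l\<close>, the truth value of \<open>m = l\<close> and that of the last condition determines the triples of all successors,
  so the number of extensions by \<open>k\<close> entries obeys a recursion on these triples
  (\<open>card_extensions_profile\<close>).

  \<^bold>\<open>Solving it.\<close> The values \<open>L - l \<ge> 2\<close> are indistinguishable for this recursion, which leaves a finite linear system of
  generating functions. Three linear dependencies (\<open>extension_count_relations\<close>) shrink it to five
  equations, whose elimination gives the stated quotient.
\<close>

section \<open>Canonical multisets and the three moves\<close>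

text \<open>The shape of a minimal endpoint representation whose largest endpoint is \<open>L\<close>: every value
  up to \<open>L\<close> is used both as a left and as a right endpoint.\<close>

definition canonical :: "nat \<Rightarrow> (nat \<times> nat) multiset \<Rightarrow> bool" where
  "canonical L M \<longleftrightarrow> fst ` set_mset M = {..L} \<and> snd ` set_mset M = {..L} \<and>
     (\<forall>a b. (a, b) \<in># M \<longrightarrow> a \<le> b)"

lemma canonicalD:
  assumes "canonical L M" "(a, b) \<in># M"
  shows "a \<le> b" "b \<le> L"
  using assms unfolding canonical_def by (blast, force)

lemma canonical_left:
  assumes "canonical L M" "a \<le> L"
  obtains b where "(a, b) \<in># M" "a \<le> b" "b \<le> L"
proof -
  have "a \<in> fst ` set_mset M" using assms by (simp add: canonical_def)
  then show thesis using that canonicalD[OF assms(1)] by force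
qed

lemma canonical_right:
  assumes "canonical L M" "b \<le> L"
  obtains a where "(a, b) \<in># M" "a \<le> b"
proof -
  have "b \<in> snd ` set_mset M" using assms by (simp add: canonical_def)
  then show thesis using that canonicalD[OF assms(1)] by force
qed

lemma canonicalI:
  assumes "\<And>a b. (a, b) \<in># M \<Longrightarrow> a \<le> b \<and> b \<le> L"
    and "\<And>a. a \<le> L \<Longrightarrow> \<exists>b. (a, b) \<in># M"
    and "\<And>b. b \<le> L \<Longrightarrow> \<exists>a. (a, b) \<in># M"
  shows "canonical L M"
  unfolding canonical_def
proof (intro conjI allI impI)
  have "a \<in> fst ` set_mset M \<longleftrightarrow> (\<exists>b. (a, b) \<in># M)" for a by force
  then show "fst ` set_mset M = {..L}" using assms(1,2) by (meson atMost_iff le_trans set_eqI)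
  have "b \<in> snd ` set_mset M \<longleftrightarrow> (\<exists>a. (a, b) \<in># M)" for b by force
  then show "snd ` set_mset M = {..L}" using assms(1,3) by (meson atMost_iff set_eqI)
qed (use assms(1) in blast)

lemma max_right_canonical: "canonical L M \<Longrightarrow> max_right M = L"
  by (auto simp: canonical_def max_right_def intro: Max_eqI)

lemma min_left_eqI:
  assumes "canonical L M" "(l, L) \<in># M" "\<And>a. (a, L) \<in># M \<Longrightarrow> l \<le> a"
  shows "min_left_of_max_right M = l"
  unfolding min_left_of_max_right_def max_right_canonical[OF assms(1)]
proof (rule Min_eqI)
  have "{a. (a, L) \<in># M} \<subseteq> {..L}" using canonicalD[OF assms(1)] by auto
  then show "finite {a. (a, L) \<in># M}" by (rule finite_subset) simp
qed (use assms in auto)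

lemma min_left_props:
  assumes "canonical L M"
  shows "(min_left_of_max_right M, L) \<in># M" "(a, L) \<in># M \<Longrightarrow> min_left_of_max_right M \<le> a"
    "min_left_of_max_right M \<le> L"
proof -
  let ?S = "{a. (a, L) \<in># M}"
  have "?S \<subseteq> {..L}" using canonicalD[OF assms(1)] by auto
  then have fin: "finite ?S" by (rule finite_subset) simp
  have ne: "?S \<noteq> {}" using canonical_right[OF assms, of L] by auto
  have eq: "min_left_of_max_right M = Min ?S"
    by (simp add: min_left_of_max_right_def max_right_canonical[OF assms])
  show "(min_left_of_max_right M, L) \<in># M" using Min_in[OF fin ne] eq by simp
  then show "min_left_of_max_right M \<le> L" using canonicalD[OF assms] by simp
  show "min_left_of_max_right M \<le> a" if "(a, L) \<in># M" using Min_le[OF fin] that eq by simp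
qed

lemma move3_shift_simp:
  assumes "a \<le> b" "b \<le> L" "i \<le> L"
  shows "move3_shift i L (a, b) =
    (if i \<le> a then (a + 1, b + 1) else if b < i then (a, b)
     else if b < L then (a, b + 1) else (a, i))"
  using assms by (auto simp: move3_shift_def)

lemma insert_interval_move1:
  assumes "canonical L M" "i \<le> min_left_of_max_right M"
  shows "insert_interval M i = add_mset (i, L) M"
  using assms by (simp add: insert_interval_def max_right_canonical)

lemma insert_interval_move2:
  assumes "canonical L M"
  shows "insert_interval M (L + 1) = add_mset (L + 1, L + 1) M"
  using assms min_left_props(3)[OF assms] by (simp add: insert_interval_def max_right_canonical)

lemma insert_interval_move3:
  assumes "canonical L M" "min_left_of_max_right M < i" "i \<le> L"
  shows "insert_interval M i = add_mset (i, L + 1) (image_mset (move3_shift i L) M)"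
  using assms by (simp add: insert_interval_def max_right_canonical)

lemma canonical_move1:
  assumes c: "canonical L M" and i: "i \<le> min_left_of_max_right M"
  shows "canonical L (insert_interval M i)" "min_left_of_max_right (insert_interval M i) = i"
proof -
  have mem: "(p, q) \<in># insert_interval M i \<longleftrightarrow> p = i \<and> q = L \<or> (p, q) \<in># M" for p q
    unfolding insert_interval_move1[OF assms] by auto
  have iL: "i \<le> L" using i min_left_props(3)[OF c] by simp
  show *: "canonical L (insert_interval M i)"
  proof (rule canonicalI)
    show "a \<le> b \<and> b \<le> L" if "(a, b) \<in># insert_interval M i" for a b
      using that canonicalD[OF c, of a b] iL unfolding mem by blast
    show "\<exists>b. (a, b) \<in># insert_interval M i" if "a \<le> L" for a
      unfolding mem using canonical_left[OF c that] by metis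
    show "\<exists>a. (a, b) \<in># insert_interval M i" if "b \<le> L" for b
      unfolding mem using canonical_right[OF c that] by metis
  qed
  show "min_left_of_max_right (insert_interval M i) = i"
  proof (rule min_left_eqI[OF *])
    show "i \<le> a" if "(a, L) \<in># insert_interval M i" for a
      using that i min_left_props(2)[OF c, of a] unfolding mem by linarith
  qed (simp add: mem)
qed

lemma canonical_move2:
  assumes c: "canonical L M"
  shows "canonical (L + 1) (insert_interval M (L + 1))"
    "min_left_of_max_right (insert_interval M (L + 1)) = L + 1"
proof -
  have mem: "(p, q) \<in># insert_interval M (L + 1) \<longleftrightarrow> p = L + 1 \<and> q = L + 1 \<or> (p, q) \<in># M" for p q
    unfolding insert_interval_move2[OF assms] by auto
  show *: "canonical (L + 1) (insert_interval M (L + 1))"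
  proof (rule canonicalI)
    show "a \<le> b \<and> b \<le> L + 1" if "(a, b) \<in># insert_interval M (L + 1)" for a b
      using that canonicalD[OF c, of a b] unfolding mem by auto
    show "\<exists>b. (a, b) \<in># insert_interval M (L + 1)" if "a \<le> L + 1" for a
    proof (cases "a = L + 1")
      case False
      then obtain b where "(a, b) \<in># M" using canonical_left[OF c, of a] \<open>a \<le> L + 1\<close> by (metis Suc_eq_plus1 le_SucE)
      then show ?thesis unfolding mem by blast
    qed (unfold mem, blast)
    show "\<exists>a. (a, b) \<in># insert_interval M (L + 1)" if "b \<le> L + 1" for b
    proof (cases "b = L + 1")
      case False
      then obtain a where "(a, b) \<in># M" using canonical_right[OF c, of b] \<open>b \<le> L + 1\<close> by (metis Suc_eq_plus1 le_SucE)
      then show ?thesis unfolding mem by blast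
    qed (unfold mem, blast)
  qed
  show "min_left_of_max_right (insert_interval M (L + 1)) = L + 1"
  proof (rule min_left_eqI[OF *])
    show "L + 1 \<le> a" if "(a, L + 1) \<in># insert_interval M (L + 1)" for a
      using that canonicalD[OF c, of a "L + 1"] unfolding mem by linarith
  qed (simp only: mem, simp)
qed

text \<open>The disjuncts are the new interval and then the intervals that Move 3 shifts, leaves alone,
  stretches at the right end and cuts at \<open>i\<close>. Comparing endpoints with \<open>i\<close> tells them apart.\<close>

lemma mem_move3:
  assumes c: "canonical L M" and i: "min_left_of_max_right M < i" "i \<le> L"
  shows "(p, q) \<in># insert_interval M i \<longleftrightarrow>
    p = i \<and> q = L + 1 \<or>
    (\<exists>a b. (a, b) \<in># M \<and> i \<le> a \<and> p = a + 1 \<and> q = b + 1) \<or>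
    (p < i \<and> q < i \<and> (p, q) \<in># M) \<or>
    (p < i \<and> i < q \<and> q \<le> L \<and> (p, q - 1) \<in># M) \<or>
    (p < i \<and> q = i \<and> (p, L) \<in># M)"
proof -
  have "(p, q) \<in># image_mset (move3_shift i L) M \<longleftrightarrow> 
     (\<exists>a b. (a, b) \<in># M \<and> (p, q) = move3_shift i L (a, b))"
    by force
  also have "\<dots> \<longleftrightarrow> (\<exists>a b. (a, b) \<in># M \<and> (p, q) = (if i \<le> a then (a + 1, b + 1) else if b < i then (a, b)
     else if b < L then (a, b + 1) else (a, i)))"
    using move3_shift_simp[OF _ _ i(2)] canonicalD[OF c] by metis
  also have "\<dots> \<longleftrightarrow> (\<exists>a b. (a, b) \<in># M \<and> i \<le> a \<and> p = a + 1 \<and> q = b + 1) \<or>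
    (p < i \<and> q < i \<and> (p, q) \<in># M) \<or>
    (p < i \<and> i < q \<and> q \<le> L \<and> (p, q - 1) \<in># M) \<or>
    (p < i \<and> q = i \<and> (p, L) \<in># M)" (is "?A \<longleftrightarrow> ?B1 \<or> ?B2 \<or> ?B3 \<or> ?B4")
  proof
    assume ?A
    then obtain a b where ab: "(a, b) \<in># M" "(p, q) = (if i \<le> a then (a + 1, b + 1) else if b < i then (a, b)
     else if b < L then (a, b + 1) else (a, i))" by blast
    have "b = L" if "\<not> b < L" using that canonicalD[OF c ab(1)] by simp
    then show "?B1 \<or> ?B2 \<or> ?B3 \<or> ?B4" using ab by (auto split: if_splits)
  next
    assume "?B1 \<or> ?B2 \<or> ?B3 \<or> ?B4"
    moreover have ?A if ?B1 using that by auto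
    moreover have ?A if ?B2 using that by (intro exI[of _ p] exI[of _ q]) auto
    moreover have ?A if ?B3 using that by (intro exI[of _ p] exI[of _ "q - 1"]) auto
    moreover have ?A if ?B4 using that i by (intro exI[of _ p] exI[of _ L]) auto
    ultimately show ?A by blast
  qed
  finally show ?thesis by (simp add: insert_interval_move3[OF assms])
qed

lemma canonical_move3:
  assumes c: "canonical L M" and i: "min_left_of_max_right M < i" "i \<le> L"
  shows "canonical (L + 1) (insert_interval M i)"
    "min_left_of_max_right (insert_interval M i) = i"
proof -
  note mem = mem_move3[OF assms]
  show *: "canonical (L + 1) (insert_interval M i)"
  proof (rule canonicalI)
    fix a b assume "(a, b) \<in># insert_interval M i"
    then consider "a = i" "b = L + 1" | a' b' where "(a', b') \<in># M" "a = a' + 1" "b = b' + 1"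
      | "(a, b) \<in># M" | "a < i" "i < b" "b \<le> L" | "a < i" "b = i"
      unfolding mem by blast
    then show "a \<le> b \<and> b \<le> L + 1"
    proof cases
      case 2
      then show ?thesis using canonicalD[OF c 2(1)] by simp
    next
      case 3
      then show ?thesis using canonicalD[OF c 3] by simp
    qed (use i in auto)
  next
    fix a assume a: "a \<le> L + 1"
    consider "a = i" | "a < i" | "i < a" by linarith
    then show "\<exists>b. (a, b) \<in># insert_interval M i"
    proof cases
      case 1
      then show ?thesis unfolding mem by blast
    next
      case 2
      then obtain b where b: "(a, b) \<in># M" "a \<le> b" "b \<le> L"
        using canonical_left[OF c, of a] i by auto
      consider "b < i" | "i \<le> b" "b < L" | "b = L" using b by linarith
      then show ?thesis
      proof cases
        assume "i \<le> b" "b < L"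
        then have "(a, b + 1) \<in># insert_interval M i" unfolding mem using 2 b by auto
        then show ?thesis ..
      qed (use 2 b in \<open>unfold mem, blast+\<close>)
    next
      case 3
      then obtain a' where a': "a = a' + 1" "i \<le> a'" by (cases a) auto
      have "a' \<le> L" using a a' by simp
      then obtain b where "(a', b) \<in># M" using canonical_left[OF c] by blast
      then have "(a, b + 1) \<in># insert_interval M i"
        unfolding mem using a' by blast
      then show ?thesis ..
    qed
  next
    fix b assume b: "b \<le> L + 1"
    consider "b = L + 1" | "b = i" | "b < i" | "i < b" "b \<le> L" using b by linarith
    then show "\<exists>a. (a, b) \<in># insert_interval M i"
    proof cases
      case 1
      then show ?thesis unfolding mem by blast
    next
      case 2
      then show ?thesis unfolding mem using min_left_props(1)[OF c] i by blast
    next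
      case 3
      then obtain a where "(a, b) \<in># M" "a \<le> b" using canonical_right[OF c, of b] i by auto
      then show ?thesis unfolding mem using 3 by (meson le_less_trans)
    next
      case 4
      then obtain b' where b': "b = b' + 1" "i \<le> b'" by (cases b) auto
      have "b' \<le> L" using b' 4 by simp
      then obtain a where a: "(a, b') \<in># M" "a \<le> b'" using canonical_right[OF c] by blast
      show ?thesis
      proof (cases "i \<le> a")
        case True
        then have "(a + 1, b) \<in># insert_interval M i" unfolding mem using a b' by blast
      then show ?thesis ..
      next
        case False
        then have "a < i \<and> i < b \<and> b \<le> L \<and> (a, b - 1) \<in># M" using a b' 4 by simp
        then show ?thesis unfolding mem by blast
      qed
    qed
  qed
  show "min_left_of_max_right (insert_interval M i) = i"
  proof (rule min_left_eqI[OF *])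
    show "(i, L + 1) \<in># insert_interval M i" unfolding mem by blast
    fix a assume "(a, L + 1) \<in># insert_interval M i"
    then show "i \<le> a" unfolding mem using i(2) by auto
  qed
qed

lemma insert_interval_cases:
  assumes "canonical L M" "i \<le> L + 1"
  obtains (move1) "i \<le> min_left_of_max_right M" "i \<le> L"
  | (move2) "i = L + 1"
  | (move3) "min_left_of_max_right M < i" "i \<le> L"
proof (cases "i \<le> min_left_of_max_right M")
  case True
  then show ?thesis using move1 min_left_props(3)[OF assms(1)] le_trans by blast
next
  case False
  then show ?thesis using move2 move3 assms(2) by (cases "i = L + 1") auto
qed

section \<open>Undoing the moves\<close>

lemma min_left_insert_interval:
  assumes "canonical L M" "i \<le> L + 1"
  shows "min_left_of_max_right (insert_interval M i) = i"
  using assms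
proof (cases rule: insert_interval_cases)
  case move1
  then show ?thesis using canonical_move1(2)[OF assms(1)] by simp
next
  case move2
  then show ?thesis using canonical_move2(2)[OF assms(1)] by simp
next
  case move3
  then show ?thesis by (rule canonical_move3(2)[OF assms(1)])
qed

lemma canonical_insert_interval:
  assumes "canonical L M" "i \<le> L + 1"
  shows "canonical (if i \<le> min_left_of_max_right M then L else L + 1) (insert_interval M i)"
  using assms
proof (cases rule: insert_interval_cases)
  case move1
  then show ?thesis using canonical_move1 assms by simp
next
  case move2
  then show ?thesis using canonical_move2[OF assms(1)] min_left_props(3)[OF assms(1)] by simp
next
  case move3
  then show ?thesis using canonical_move3[OF assms(1) move3] by simp
qed

lemma size_insert_interval: "size (insert_interval M i) = size M + 1"
  by (simp add: insert_interval_def Let_def)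

text \<open>Every value up to \<open>L\<close> is already a left endpoint, so Move 1 repeats the left endpoint \<open>i\<close>.
  Move 2 uses a fresh value, and Move 3 raises all left endpoints from \<open>i\<close> on, so that only the new
  interval starts at \<open>i\<close>. The multiplicity of the left endpoint \<open>i\<close> therefore reveals whether the
  last step was Move 1.\<close>

lemma left_count_insert_interval:
  assumes c: "canonical L M" and i: "i \<le> L + 1"
  shows "size (filter_mset (\<lambda>p. fst p = i) (insert_interval M i)) > 1
    \<longleftrightarrow> i \<le> min_left_of_max_right M"
  using assms
proof (cases rule: insert_interval_cases)
  case move1
  then obtain b where b: "(i, b) \<in># M" using canonical_left[OF c, of i] by blast
  then have "(i, b) \<in># filter_mset (\<lambda>p. fst p = i) M" by simp
  then have "0 < size (filter_mset (\<lambda>p. fst p = i) M)" by (simp only: size_eq_0_iff_empty neq0_conv[symmetric]) auto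
  then show ?thesis using move1 by (simp add: insert_interval_move1[OF c])
next
  case move2
  have "filter_mset (\<lambda>p. fst p = i) M = {#}"
    unfolding filter_mset_eq_mempty_iff
  proof (intro allI impI)
    fix p assume "p \<in># M"
    then show "fst p \<noteq> i" using canonicalD[OF c, of "fst p" "snd p"] move2 by simp
  qed
  then show ?thesis using move2 min_left_props(3)[OF c] by (simp add: insert_interval_move2[OF c, simplified])
next
  case move3
  have "filter_mset (\<lambda>p. fst p = i) (image_mset (move3_shift i L) M) = {#}"
    unfolding filter_mset_eq_mempty_iff
  proof (intro allI impI)
    fix p assume "p \<in># image_mset (move3_shift i L) M"
    then obtain a b where "(a, b) \<in># M" "p = move3_shift i L (a, b)" by auto
    then show "fst p \<noteq> i"
      using canonicalD[OF c, of a b] move3 by (simp add: move3_shift_simp)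
  qed
  then show ?thesis using move3 by (simp add: insert_interval_move3[OF c])
qed

lemma inj_on_move3_shift:
  assumes "i \<le> L"
  shows "inj_on (move3_shift i L) {(a, b). a \<le> b \<and> b \<le> L}"
  using assms by (auto simp: inj_on_def move3_shift_simp split: if_splits)

lemma image_mset_inj_on_eq:
  assumes "image_mset f M = image_mset f N" "inj_on f A" "set_mset M \<subseteq> A" "set_mset N \<subseteq> A"
  shows "M = N"
proof -
  have *: "image_mset (inv_into A f) (image_mset f K) = K" if "set_mset K \<subseteq> A" for K
  proof -
    have "image_mset (inv_into A f) (image_mset f K) = image_mset (\<lambda>x. x) K"
      unfolding multiset.map_comp
      by (rule image_mset_cong) (use that assms(2) inv_into_f_f in fastforce)
    then show ?thesis by simp
  qed
  show ?thesis using *[OF assms(3)] *[OF assms(4)] assms(1) by metis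
qed

text \<open>Each step of the construction can be undone. The entry \<open>i\<close> is the smallest left endpoint of the
  result among the intervals that reach its largest right endpoint; the multiplicity of \<open>i\<close> as
  a left endpoint identifies Move 1, Move 2 is the case where \<open>i\<close> is the new maximum, and
  the shift of Move 3 is injective.\<close>

lemma insert_interval_inject:
  assumes c: "canonical L M" and c': "canonical L' M'" and i: "i \<le> L + 1" and j: "j \<le> L' + 1"
    and eq: "insert_interval M i = insert_interval M' j"
  shows "i = j" "M = M'"
proof -
  show ij: "i = j"
    using min_left_insert_interval[OF c i] min_left_insert_interval[OF c' j] eq by simp
  have move1_iff: "i \<le> min_left_of_max_right M \<longleftrightarrow> i \<le> min_left_of_max_right M'"
    using left_count_insert_interval[OF c i] left_count_insert_interval[OF c' j] eq ij by simp
  have LL: "L = L'"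
    using max_right_canonical[OF canonical_insert_interval[OF c i]]
      max_right_canonical[OF canonical_insert_interval[OF c' j]] eq ij move1_iff by (simp split: if_splits)
  show "M = M'"
    using c i
  proof (cases rule: insert_interval_cases)
    case move1
    then show ?thesis
      using eq insert_interval_move1[OF c move1(1)] insert_interval_move1[OF c', of j] ij LL move1_iff by simp
  next
    case move2
    then show ?thesis
      using eq insert_interval_move2[OF c] insert_interval_move2[OF c'] ij LL by simp
  next
    case move3
    have "image_mset (move3_shift i L) M = image_mset (move3_shift i L) M'"
      using eq insert_interval_move3[OF c move3] insert_interval_move3[OF c', of j] ij LL move1_iff move3 by simp
    then show ?thesis
      by (rule image_mset_inj_on_eq[OF _ inj_on_move3_shift[OF move3(2)]])
        (auto dest: canonicalD[OF c] canonicalD[OF c', folded LL])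
  qed
qed

section \<open>Ascent sequences\<close>

lemma asc_snoc: "asc (xs @ [x]) = asc xs + (if xs \<noteq> [] \<and> last xs < x then 1 else 0)"
proof -
  let ?A = "{j. Suc j < length xs \<and> xs ! j < xs ! Suc j}"
  have fin: "finite ?A" by (rule finite_subset[of _ "{..<length xs}"]) auto
  have "{j. Suc j < length (xs @ [x]) \<and> (xs @ [x]) ! j < (xs @ [x]) ! Suc j} =
     ?A \<union> (if xs \<noteq> [] \<and> last xs < x then {length xs - 1} else {})" (is "?B = ?C")
  proof (rule set_eqI)
    fix j
    consider "Suc j < length xs" | "xs \<noteq> []" "j = length xs - 1" 
      | "length xs \<le> j" "xs \<noteq> [] \<longrightarrow> j \<noteq> length xs - 1" by (cases xs) force+
    then show "j \<in> ?B \<longleftrightarrow> j \<in> ?C"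
      by cases (auto simp: nth_append last_conv_nth)
  qed
  moreover have "length xs - 1 \<notin> ?A" by auto
  ultimately show ?thesis unfolding asc_def using fin by simp
qed

lemma ascent_sequence_singleton: "ascent_sequence [x] \<longleftrightarrow> x = 0"
  by (auto simp: ascent_sequence_def)

lemma ascent_sequence_snoc:
  assumes "xs \<noteq> []"
  shows "ascent_sequence (xs @ [x]) \<longleftrightarrow> ascent_sequence xs \<and> x \<le> asc xs + 1"
proof -
  have "{1..<length (xs @ [x])} = insert (length xs) {1..<length xs}" using assms by (cases xs) auto
  moreover have "(\<forall>i\<in>{1..<length xs}. (xs @ [x]) ! i \<le> 1 + asc (take i (xs @ [x]))) \<longleftrightarrow>
     (\<forall>i\<in>{1..<length xs}. xs ! i \<le> 1 + asc (take i xs))"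
    by (intro ball_cong) (auto simp: nth_append)
  ultimately show ?thesis using assms unfolding ascent_sequence_def by (auto simp: nth_append)
qed

lemma Psi_inv_rep_snoc: "xs \<noteq> [] \<Longrightarrow> Psi_inv_rep (xs @ [x]) = insert_interval (Psi_inv_rep xs) x"
  by (simp add: Psi_inv_rep_def)

lemma Psi_inv_rep_singleton: "Psi_inv_rep [x] = {#(0, 0)#}"
  by (simp add: Psi_inv_rep_def)

lemma canonical_zero: "canonical 0 {#(0, 0)#}"
  by (simp add: canonical_def)

lemma min_left_zero: "min_left_of_max_right {#(0, 0)#} = 0"
  by (rule min_left_eqI[OF canonical_zero]) auto

text \<open>The last entry equals the smallest left endpoint \<open>l\<close> of the intervals ending at the maximum, and the
  maximum grows exactly in Moves 2 and 3, that is, when the next entry exceeds \<open>l\<close>. Hence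
  the maximum counts the ascents.\<close>

lemma canonical_Psi_inv_rep:
  assumes "ascent_sequence xs"
  shows "canonical (asc xs) (Psi_inv_rep xs)" "min_left_of_max_right (Psi_inv_rep xs) = last xs"
    "size (Psi_inv_rep xs) = length xs"
proof -
  have "canonical (asc xs) (Psi_inv_rep xs) \<and> min_left_of_max_right (Psi_inv_rep xs) = last xs
    \<and> size (Psi_inv_rep xs) = length xs"
    using assms
  proof (induction xs rule: rev_induct)
    case Nil
    then show ?case by (simp add: ascent_sequence_def)
  next
    case (snoc x xs)
    show ?case
    proof (cases "xs = []")
      case True
      then show ?thesis using snoc.prems canonical_zero min_left_zero
        by (simp add: ascent_sequence_singleton Psi_inv_rep_singleton asc_def)
    next
      case False
      then have xs: "ascent_sequence xs" "x \<le> asc xs + 1"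
        using snoc.prems ascent_sequence_snoc by auto
      have c: "canonical (asc xs) (Psi_inv_rep xs)" and l: "min_left_of_max_right (Psi_inv_rep xs) = last xs"
        and s: "size (Psi_inv_rep xs) = length xs"
        using snoc.IH xs by auto
      show ?thesis
        using canonical_insert_interval[OF c xs(2)] min_left_insert_interval[OF c xs(2)] l s False
        by (simp add: Psi_inv_rep_snoc asc_snoc size_insert_interval split: if_splits)
    qed
  qed
  then show "canonical (asc xs) (Psi_inv_rep xs)" "min_left_of_max_right (Psi_inv_rep xs) = last xs"
    "size (Psi_inv_rep xs) = length xs" by auto
qed

lemma inj_on_Psi_inv_rep: "inj_on Psi_inv_rep {xs. ascent_sequence xs}"
proof (rule inj_onI)
  fix xs ys assume "xs \<in> {xs. ascent_sequence xs}" "ys \<in> {xs. ascent_sequence xs}"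
    and "Psi_inv_rep xs = Psi_inv_rep ys"
  then show "xs = ys"
  proof (induction xs arbitrary: ys rule: rev_induct)
    case Nil
    then show ?case by (simp add: ascent_sequence_def)
  next
    case (snoc x xs)
    have len: "length (xs @ [x]) = length ys"
      using canonical_Psi_inv_rep(3) snoc.prems by (metis mem_Collect_eq)
    then obtain zs z where ys: "ys = zs @ [z]" by (cases ys rule: rev_cases) auto
    show ?case
    proof (cases "xs = []")
      case True
      then show ?thesis using snoc.prems len ys by (simp add: ascent_sequence_singleton)
    next
      case False
      with len ys have False': "zs \<noteq> []" by auto
      have xs: "ascent_sequence xs" "x \<le> asc xs + 1" and zs: "ascent_sequence zs" "z \<le> asc zs + 1"
        using snoc.prems ys False False' ascent_sequence_snoc by auto
      have "insert_interval (Psi_inv_rep xs) x = insert_interval (Psi_inv_rep zs) z"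
        using snoc.prems ys False False' by (simp add: Psi_inv_rep_snoc)
      from insert_interval_inject[OF canonical_Psi_inv_rep(1)[OF xs(1)] canonical_Psi_inv_rep(1)[OF zs(1)] xs(2) zs(2) this]
      show ?thesis using snoc.IH[of zs] xs zs ys by simp
    qed
  qed
qed

section \<open>Minimal endpoint representations of posets\<close>

text \<open>The position of a member in a strictly increasing enumeration is determined by the enumerated set
  alone. This and its decreasing counterpart make minimal endpoint representations unique.\<close>

lemma strict_mono_on_index:
  fixes D :: "nat \<Rightarrow> 'a :: order"
  assumes "strict_mono_on {..<t} D" "i < t"
  shows "card {z \<in> D ` {..<t}. z < D i} = i"
proof -
  have lt: "D j < D i \<longleftrightarrow> j < i" if "j < t" for j
  proof -
    consider "j < i" | "j = i" | "i < j" by linarith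
    then show ?thesis
      by cases (use strict_mono_onD[OF assms(1), of j i] strict_mono_onD[OF assms(1), of i j] that assms(2) in auto)
  qed
  have "{z \<in> D ` {..<t}. z < D i} = D ` {..<i}" using lt assms(2) by auto
  moreover have "inj_on D {..<i}"
    using strict_mono_on_imp_inj_on[OF assms(1)] assms(2) by (auto intro: inj_on_subset)
  ultimately show ?thesis by (simp add: card_image)
qed

lemma strict_antimono_on_index:
  fixes U :: "nat \<Rightarrow> 'a set"
  assumes "strict_antimono_on {..<t} U" "i < t"
  shows "card {z \<in> U ` {..<t}. U i \<subset> z} = i"
proof -
  have anti: "U k \<subset> U j" if "j < k" "k < t" for j k
    using monotone_onD[OF assms(1), of j k] that by simp
  have lt: "U i \<subset> U j \<longleftrightarrow> j < i" if "j < t" for j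
  proof -
    consider "j < i" | "j = i" | "i < j" by linarith
    then show ?thesis by cases (use anti[of j i] anti[of i j] that assms(2) in auto)
  qed
  have "{z \<in> U ` {..<t}. U i \<subset> z} = U ` {j \<in> {..<t}. U i \<subset> U j}" by blast
  also have "{j \<in> {..<t}. U i \<subset> U j} = {..<i}"
  proof (rule set_eqI)
    fix j show "j \<in> {j \<in> {..<t}. U i \<subset> U j} \<longleftrightarrow> j \<in> {..<i}"
      using lt[of j] assms(2) by (cases "j < t") simp_all
  qed
  finally have "{z \<in> U ` {..<t}. U i \<subset> z} = U ` {..<i}" .
  moreover have "inj_on U {..<i}"
  proof (rule linorder_inj_onI)
    show "U j \<noteq> U k" if "j < k" "j \<in> {..<i}" "k \<in> {..<i}" for j k
      using anti[of j k] that assms(2) by auto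
  qed auto
  ultimately show ?thesis by (simp add: card_image)
qed

lemma minimal_endpoint_rep_eq:
  assumes "minimal_endpoint_rep X r I" "x \<in> X"
  shows "I x = (card {d \<in> down_set X r ` X. d \<subset> down_set X r x},
                card {u \<in> up_set X r ` X. up_set X r x \<subset> u})"
proof -
  obtain t D U where D: "down_set X r ` X = D ` {..<t}" "strict_mono_on {..<t} D"
    and U: "up_set X r ` X = U ` {..<t}" "strict_antimono_on {..<t} U"
    and I: "\<forall>x\<in>X. fst (I x) < t \<and> snd (I x) < t \<and>
                down_set X r x = D (fst (I x)) \<and> up_set X r x = U (snd (I x))"
    using assms(1) unfolding minimal_endpoint_rep_def by (elim exE conjE) (rule that)
  have x: "fst (I x) < t" "snd (I x) < t" "down_set X r x = D (fst (I x))" "up_set X r x = U (snd (I x))"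
    using I assms(2) by blast+
  show ?thesis
    unfolding D(1) U(1) x(3,4) strict_mono_on_index[OF D(2) x(1)] strict_antimono_on_index[OF U(2) x(2)]
    by simp
qed

lemma minimal_endpoint_rep_poset_iso:
  assumes I: "minimal_endpoint_rep X r I" and J: "minimal_endpoint_rep Y s J"
    and iso: "poset_iso X r Y s"
  shows "image_mset I (mset_set X) = image_mset J (mset_set Y)"
proof -
  obtain f where f: "bij_betw f X Y" and rs: "\<forall>x\<in>X. \<forall>y\<in>X. (x, y) \<in> r \<longleftrightarrow> (f x, f y) \<in> s"
    using iso unfolding poset_iso_def by blast
  have inj: "inj_on f X" and Y: "Y = f ` X" using f by (auto simp: bij_betw_def)
  have below: "strictly_below s (f x) (f y) \<longleftrightarrow> strictly_below r x y" if "x \<in> X" "y \<in> X" for x y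
    using that rs inj by (auto simp: strictly_below_def inj_on_eq_iff)
  have down: "down_set Y s (f x) = f ` down_set X r x" if "x \<in> X" for x
    using that below by (auto simp: down_set_def Y)
  have up: "up_set Y s (f x) = f ` up_set X r x" if "x \<in> X" for x
    using that below by (auto simp: up_set_def Y)
  have sub: "f ` A \<subset> f ` B \<longleftrightarrow> A \<subset> B" if "A \<subseteq> X" "B \<subseteq> X" for A B
  proof -
    have subeq: "A' \<subseteq> B'" if "f ` A' \<subseteq> f ` B'" "A' \<subseteq> X" "B' \<subseteq> X" for A' B'
      using that inj_on_image_mem_iff[OF inj] by blast
    show ?thesis using subeq[of A B] subeq[of B A] that by blast
  qed
  have dX: "down_set X r x \<subseteq> X" "up_set X r x \<subseteq> X" for x by (auto simp: down_set_def up_set_def)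
  have injim: "inj_on ((`) f) A" if "A \<subseteq> Pow X" for A
    by (rule inj_on_subset[OF inj_on_image_Pow[OF inj] that])
  have Pw: "{d \<in> h ` X. Q d} \<subseteq> Pow X" if "\<And>x. h x \<subseteq> X" for h :: "'a \<Rightarrow> 'a set" and Q
    using that by auto
  have filt: "{z \<in> g ` \<A>. Q z} = g ` {d \<in> \<A>. Q (g d)}" for g :: "'a set \<Rightarrow> 'b set" and \<A> Q
    by blast
  have "I x = J (f x)" if x: "x \<in> X" for x
  proof -
    have "{d \<in> down_set Y s ` Y. d \<subset> down_set Y s (f x)} =
        (`) f ` {d \<in> down_set X r ` X. d \<subset> down_set X r x}"
    proof -
      have "down_set Y s ` Y = (`) f ` down_set X r ` X"
        unfolding Y image_image by (rule image_cong[OF refl], rule down[unfolded Y])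
      moreover have "{d \<in> down_set X r ` X. f ` d \<subset> f ` down_set X r x} =
          {d \<in> down_set X r ` X. d \<subset> down_set X r x}"
        by (intro Collect_cong conj_cong refl) (elim imageE, simp only: sub[OF dX(1) dX(1)] sub[OF dX(2) dX(2)])
      ultimately show ?thesis unfolding down[OF x] by (simp only: filt)
    qed
    then have 1: "card {d \<in> down_set Y s ` Y. d \<subset> down_set Y s (f x)} =
      card {d \<in> down_set X r ` X. d \<subset> down_set X r x}"
      by (simp only:) (rule card_image, rule injim, rule Pw, rule dX(1))
    have "{d \<in> up_set Y s ` Y. up_set Y s (f x) \<subset> d} =
        (`) f ` {d \<in> up_set X r ` X. up_set X r x \<subset> d}"
    proof -
      have "up_set Y s ` Y = (`) f ` up_set X r ` X"
        unfolding Y image_image by (rule image_cong[OF refl], rule up[unfolded Y])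
      moreover have "{d \<in> up_set X r ` X. f ` up_set X r x \<subset> f ` d} =
          {d \<in> up_set X r ` X. up_set X r x \<subset> d}"
        by (intro Collect_cong conj_cong refl) (elim imageE, simp only: sub[OF dX(1) dX(1)] sub[OF dX(2) dX(2)])
      ultimately show ?thesis unfolding up[OF x] by (simp only: filt)
    qed
    then have 2: "card {d \<in> up_set Y s ` Y. up_set Y s (f x) \<subset> d} =
      card {d \<in> up_set X r ` X. up_set X r x \<subset> d}"
      by (simp only:) (rule card_image, rule injim, rule Pw, rule dX(2))
    have "f x \<in> Y" using x Y by simp
    then show ?thesis
      using minimal_endpoint_rep_eq[OF I x] minimal_endpoint_rep_eq[OF J] 1 2 by simp
  qed
  then have "image_mset I (mset_set X) = image_mset J (image_mset f (mset_set X))"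
    unfolding multiset.map_comp by (cases "finite X") (auto intro!: image_mset_cong)
  also have "image_mset f (mset_set X) = mset_set Y"
    unfolding Y by (rule image_mset_mset_set[OF inj])
  finally show ?thesis .
qed

lemma poset_strictly_below:
  assumes "poset X r"
  shows "\<not> strictly_below r x x" "strictly_below r x y \<Longrightarrow> strictly_below r y z \<Longrightarrow> strictly_below r x z"
    "strictly_below r x y \<Longrightarrow> x \<in> X \<and> y \<in> X"
  using assms unfolding poset_def partial_order_on_def preorder_on_def strictly_below_def
  by (auto dest: transD antisymD)

lemma poset_rel_iff:
  assumes "poset X r" "x \<in> X"
  shows "(x, y) \<in> r \<longleftrightarrow> x = y \<or> strictly_below r x y"
  using assms by (auto simp: poset_def partial_order_on_def preorder_on_def refl_on_def strictly_below_def)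

text \<open>Whether \<open>x\<close> is below \<open>y\<close> depends only on the right index \<open>j\<close> of \<open>x\<close> and the left index \<open>i\<close> of
  \<open>y\<close>. For fixed \<open>i\<close> let \<open>S i\<close> be the set of the right indices \<open>j\<close> of points below. It is an initial
  segment of \<open>{..<t}\<close> because the up sets decrease, it grows strictly with \<open>i\<close> because the down sets
  do, and \<open>S (t - 1)\<close> misses \<open>t - 1\<close> because a point with the smallest up set is maximal. There is room
  for only one such family: \<open>S i = {..<i}\<close>.\<close>

lemma strictly_below_iff_endpoints:
  assumes P: "poset X r" and rep: "minimal_endpoint_rep X r I" and x: "x \<in> X" and y: "y \<in> X"
  shows "strictly_below r x y \<longleftrightarrow> snd (I x) < fst (I y)"
proof -
  obtain t D U where D: "down_set X r ` X = D ` {..<t}" "strict_mono_on {..<t} D"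
    and U: "up_set X r ` X = U ` {..<t}" "strict_antimono_on {..<t} U"
    and "\<forall>x\<in>X. fst (I x) < t \<and> snd (I x) < t \<and>
                down_set X r x = D (fst (I x)) \<and> up_set X r x = U (snd (I x))"
    using rep unfolding minimal_endpoint_rep_def by (elim exE conjE) (rule that)
  then have I: "fst (I x) < t \<and> snd (I x) < t \<and>
      down_set X r x = D (fst (I x)) \<and> up_set X r x = U (snd (I x))" if "x \<in> X" for x
    using that by (rule_tac bspec)
  have Dmono: "D i \<subset> D j" if "i < j" "j < t" for i j
    using strict_mono_onD[OF D(2), of i j] that by simp
  have Uanti: "U j \<subset> U i" if "i < j" "j < t" for i j
    using monotone_onD[OF U(2), of i j] that by simp
  have memD: "x \<in> D (fst (I y)) \<longleftrightarrow> strictly_below r x y" if "x \<in> X" "y \<in> X" for x y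
    using I[OF that(2)] that(1) by (auto simp: down_set_def)
  have memU: "y \<in> U (snd (I x)) \<longleftrightarrow> strictly_below r x y" if "x \<in> X" "y \<in> X" for x y
    using I[OF that(1)] that(2) by (auto simp: up_set_def)
  have left: "\<exists>y\<in>X. fst (I y) = i" if "i < t" for i
  proof -
    have "D i \<in> down_set X r ` X" unfolding D(1) using that by simp
    then obtain y where y: "y \<in> X" "down_set X r y = D i" by (metis imageE)
    then have eq: "D (fst (I y)) = D i" "fst (I y) < t" using I[OF y(1)] by simp_all
    have "fst (I y) = i"
      using Dmono[of "fst (I y)" i] Dmono[of i "fst (I y)"] eq that
      by (cases "fst (I y)" i rule: linorder_cases) simp_all
    then show ?thesis using y(1) by blast
  qed
  have right: "\<exists>y\<in>X. snd (I y) = i" if "i < t" for i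
  proof -
    have "U i \<in> up_set X r ` X" unfolding U(1) using that by simp
    then obtain y where y: "y \<in> X" "up_set X r y = U i" by (metis imageE)
    then have eq: "U (snd (I y)) = U i" "snd (I y) < t" using I[OF y(1)] by simp_all
    have "snd (I y) = i"
      using Uanti[of "snd (I y)" i] Uanti[of i "snd (I y)"] eq that
      by (cases "snd (I y)" i rule: linorder_cases) simp_all
    then show ?thesis using y(1) by blast
  qed
  have DX: "D i \<subseteq> X" if i: "i < t" for i
  proof -
    obtain y where y: "y \<in> X" "fst (I y) = i" using left[OF i] by blast
    then have "D i = down_set X r y" using I[OF y(1)] by simp
    then show ?thesis by (auto simp: down_set_def)
  qed
  define S where "S i = (\<lambda>x. snd (I x)) ` D i" for i
  have memS: "snd (I x) \<in> S (fst (I y)) \<longleftrightarrow> strictly_below r x y" if "x \<in> X" "y \<in> X" for x y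
  proof
    assume "snd (I x) \<in> S (fst (I y))"
    then obtain x' where x': "x' \<in> D (fst (I y))" "snd (I x') = snd (I x)" by (auto simp: S_def)
    have "x' \<in> X" using x'(1) DX I that(2) by blast
    then show "strictly_below r x y" using x' memD memU that by metis
  qed (use memD that in \<open>auto simp: S_def\<close>)
  have down: "j' \<in> S i" if jS: "j \<in> S i" and jj: "j' \<le> j" and it: "i < t" for i j j'
  proof -
    obtain x where x: "x \<in> X" "snd (I x) = j" "x \<in> D i"
      using jS DX[OF it] unfolding S_def by blast
    obtain z where z: "z \<in> X" "fst (I z) = i" using left[OF it] by blast
    have j: "j < t" using I[OF x(1)] x(2) by simp
    obtain x' where x': "x' \<in> X" "snd (I x') = j'" using right[of j'] jj j by auto
    have "U j \<subseteq> U j'" using Uanti[of j' j] j jj by (cases "j = j'") auto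
    then have "strictly_below r x' z" using memU memD x x' z by (metis subsetD)
    then show ?thesis using memS x' z by metis
  qed
  \<comment> \<open>A strictly larger initial segment contains at least one more index.\<close>
  have step: "{..<Suc n} \<subseteq> S (Suc k)" if n: "{..<n} \<subseteq> S k" and k: "Suc k < t" for n k
  proof -
    obtain z where z: "z \<in> D (Suc k)" "z \<notin> D k" using Dmono[of k "Suc k"] k by blast
    have zX: "z \<in> X" using DX z k by blast
    obtain y where y: "y \<in> X" "fst (I y) = k" using left k by (metis Suc_lessD)
    have "snd (I z) \<notin> S k" using memS[OF zX y(1)] memD[OF zX y(1)] y z by simp
    then have "n \<le> snd (I z)" using n by (metis lessThan_iff not_le subsetD)
    moreover have "snd (I z) \<in> S (Suc k)" using z by (simp add: S_def)
    ultimately show ?thesis using down k by (metis le_trans less_Suc_eq_le lessThan_iff subsetI)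
  qed
  have lower: "{..<i} \<subseteq> S i" if "i < t" for i
    using that by (induction i) (use step in auto)
  have t: "t > 0" using I[OF x] by auto
  have "S (t - 1) \<subseteq> {..<t - 1}"
  proof
    fix j assume j: "j \<in> S (t - 1)"
    obtain m where m: "m \<in> X" "snd (I m) = t - 1" using right[of "t - 1"] t by auto
    have "\<not> strictly_below r m z" for z
    proof
      assume mz: "strictly_below r m z"
      then have z: "z \<in> X" using poset_strictly_below[OF P] by blast
      then have "up_set X r z \<subset> up_set X r m"
        using mz poset_strictly_below[OF P] unfolding up_set_def by blast
      then have "U (snd (I z)) \<subset> U (t - 1)" using I[OF z] I[OF m(1)] m(2) by simp
      moreover have "snd (I z) < t - 1 \<or> snd (I z) = t - 1" using I[OF z] by linarith
      ultimately show False using Uanti[of "snd (I z)" "t - 1"] t by auto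
    qed
    moreover obtain z where "z \<in> X" "fst (I z) = t - 1" using left[of "t - 1"] t by auto
    ultimately have "t - 1 \<notin> S (t - 1)" using memS m by metis
    then show "j \<in> {..<t - 1}" using down[OF j, of "t - 1"] t by (metis diff_less lessThan_iff linorder_not_less zero_less_one)
  qed
  then have top: "t - 1 \<notin> S (t - 1)" by auto
  have upper: "i \<notin> S i" if i: "i < t" for i
  proof
    assume "i \<in> S i"
    then have "{..<Suc i} \<subseteq> S i" using lower[OF i] by (simp add: lessThan_Suc)
    then have "{..<Suc (i + k)} \<subseteq> S (i + k)" if "i + k < t" for k
      using that by (induction k) (use step in auto)
    from this[of "t - 1 - i"] have "{..<t} \<subseteq> S (t - 1)" using i by simp
    moreover have "t - 1 \<in> {..<t}" using t by simp
    ultimately show False using top by blast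
  qed
  have "S i = {..<i}" if "i < t" for i
    using lower[OF that] upper[OF that] down[OF _ _ that] by (metis lessThan_iff not_le subsetI subset_antisym)
  then show ?thesis using memS[OF x y] I[OF y] by simp
qed

lemma poset_iso_if_endpoints_eq:
  assumes X: "poset X r" "minimal_endpoint_rep X r I" and Y: "poset Y s" "minimal_endpoint_rep Y s J"
    and eq: "image_mset I (mset_set X) = image_mset J (mset_set Y)"
  shows "poset_iso X r Y s"
proof -
  have fin: "finite X" "finite Y" using X Y by (auto simp: poset_def)
  obtain xs ys where xs: "set xs = X" "distinct xs" and ys: "set ys = Y" "distinct ys"
    using finite_distinct_list fin by metis
  have mX: "mset_set X = mset xs" and mY: "mset_set Y = mset ys"
    using mset_set_set[OF xs(2)] mset_set_set[OF ys(2)] xs(1) ys(1) by auto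
  have msets: "mset (map I xs) = mset (map J ys)" using eq by (simp add: mX mY)
  then obtain ys' where len: "length ys' = length (map I xs)"
    and zip: "mset (zip (map I xs) ys') = mset (zip (map J ys) ys)"
    using ex_mset_zip_left[of "map J ys" ys "map I xs"] by auto
  have "image_mset snd (mset (zip (map I xs) ys')) = image_mset snd (mset (zip (map J ys) ys))"
    by (simp only: zip)
  then have ys': "mset ys' = mset ys" using len by (simp flip: mset_map)
  have "set (zip (map I xs) ys') = set (zip (map J ys) ys)" using zip by (rule mset_eq_setD)
  then have JI: "J (ys' ! k) = I (xs ! k)" if "k < length xs" for k
  proof -
    have "(I (xs ! k), ys' ! k) \<in> set (zip (map I xs) ys')"
      using that len by (force simp: set_zip)
    then have "(I (xs ! k), ys' ! k) \<in> set (zip (map J ys) ys)" 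
      using \<open>set (zip (map I xs) ys') = set (zip (map J ys) ys)\<close> by simp
    then show ?thesis by (auto simp: set_zip)
  qed
  let ?N = "{..<length xs}"
  have bx: "bij_betw ((!) xs) ?N X" using xs by (intro bij_betw_nth) auto
  have "distinct ys'" "set ys' = Y" using ys ys' mset_eq_imp_distinct_iff mset_eq_setD by metis+
  then have by': "bij_betw ((!) ys') ?N Y" using len by (intro bij_betw_nth) auto
  define f where "f = (!) ys' \<circ> inv_into ?N ((!) xs)"
  have f: "bij_betw f X Y" unfolding f_def by (rule bij_betw_trans[OF bij_betw_inv_into[OF bx] by'])
  have Jf: "J (f x) = I x" if "x \<in> X" for x
  proof -
    have k: "inv_into ?N ((!) xs) x \<in> ?N" "xs ! inv_into ?N ((!) xs) x = x"
      using bx that by (auto simp: bij_betw_def inv_into_into f_inv_into_f)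
    then show ?thesis using JI by (simp add: f_def)
  qed
  have "(x, y) \<in> r \<longleftrightarrow> (f x, f y) \<in> s" if "x \<in> X" "y \<in> X" for x y
  proof -
    have fX: "f x \<in> Y" "f y \<in> Y" using f that by (auto simp: bij_betw_def)
    have "f x = f y \<longleftrightarrow> x = y" using f that by (auto simp: bij_betw_def inj_on_eq_iff)
    moreover have "strictly_below s (f x) (f y) \<longleftrightarrow> strictly_below r x y"
      by (simp add: strictly_below_iff_endpoints[OF X that] strictly_below_iff_endpoints[OF Y fX] Jf that)
    ultimately show ?thesis using poset_rel_iff[OF X(1) that(1)] poset_rel_iff[OF Y(1) fX(1)] by simp
  qed
  then show ?thesis unfolding poset_iso_def using f by blast
qed

lemma strict_antimono_on_setI:
  assumes "\<And>i j. i < j \<Longrightarrow> j < t \<Longrightarrow> U j \<subset> U i"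
  shows "strict_antimono_on {..<t::nat} U"
  using assms by (intro monotone_onI) auto

lemma ex_interval_order_canonical:
  assumes c: "canonical L M"
  obtains s :: "nat rel" and I where "interval_order {..<size M} s"
    "minimal_endpoint_rep {..<size M} s I" "image_mset I (mset_set {..<size M}) = M"
proof -
  obtain ms where ms: "mset ms = M" using ex_mset by blast
  define n where "n = size M"
  have n: "n = length ms" by (simp add: n_def flip: ms)
  define I where "I = (!) ms"
  define s where "s = {(x, y). x < n \<and> y < n \<and> (x = y \<or> snd (I x) < fst (I y))}"
  have img: "image_mset I (mset_set {..<n}) = M"
  proof -
    have "mset (map I [0..<n]) = M" by (simp add: I_def n map_nth ms)
    then show ?thesis by (simp add: atLeast0LessThan)
  qed
  have I: "I x \<in># M" if "x < n" for x
    using that by (auto simp: I_def n simp flip: ms)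
  have le: "fst (I x) \<le> snd (I x)" "snd (I x) \<le> L" if "x < n" for x
    using canonicalD[OF c, of "fst (I x)" "snd (I x)"] I[OF that] by auto
  have ex: "\<exists>x<n. I x = p" if "p \<in># M" for p
    using that unfolding I_def n by (metis in_set_conv_nth ms set_mset_mset)
  have left: "\<exists>x<n. fst (I x) = i" if i: "i \<le> L" for i
  proof -
    obtain b where "(i, b) \<in># M" using canonical_left[OF c i] by blast
    from ex[OF this] show ?thesis by force
  qed
  have right: "\<exists>x<n. snd (I x) = i" if i: "i \<le> L" for i
  proof -
    obtain a where "(a, i) \<in># M" using canonical_right[OF c i] by blast
    from ex[OF this] show ?thesis by force
  qed
  have below: "strictly_below s x y \<longleftrightarrow> snd (I x) < fst (I y)" if "x < n" "y < n" for x y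
    using that le[of x] by (auto simp: strictly_below_def s_def)
  have "n > 0" using left[of 0] by auto
  moreover have "trans s" unfolding s_def trans_def using le
    by (auto, meson le_less_trans less_trans)
  moreover have "antisym s" unfolding s_def antisym_def using le
    by (auto, meson le_less_trans less_asym)
  ultimately have P: "poset {..<n} s"
    unfolding poset_def partial_order_on_def preorder_on_def refl_on_def by (auto simp: s_def)
  have io: "interval_order {..<n} s"
    unfolding interval_order_def real_interval_rep_def
    using P below le by (intro conjI exI[of _ "\<lambda>x. real (fst (I x))"] exI[of _ "\<lambda>x. real (snd (I x))"]) auto
  have downs: "down_set {..<n} s x = {y. y < n \<and> snd (I y) < fst (I x)}" if "x < n" for x
    using that below by (auto simp: down_set_def)
  have ups: "up_set {..<n} s x = {y. y < n \<and> snd (I x) < fst (I y)}" if "x < n" for x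
    using that below by (auto simp: up_set_def)
  define D where "D i = {y. y < n \<and> snd (I y) < i}" for i
  define U where "U i = {y. y < n \<and> i < fst (I y)}" for i
  have rep: "minimal_endpoint_rep {..<n} s I"
    unfolding minimal_endpoint_rep_def
  proof (intro exI conjI ballI)
    have fst_img: "(\<lambda>x. fst (I x)) ` {..<n} = {..<L + 1}" using left le by (fastforce simp: less_Suc_eq_le)
    have snd_img: "(\<lambda>x. snd (I x)) ` {..<n} = {..<L + 1}" using right le by (fastforce simp: less_Suc_eq_le)
    have "down_set {..<n} s ` {..<n} = D ` (\<lambda>x. fst (I x)) ` {..<n}"
      unfolding image_image by (rule image_cong) (auto simp: downs D_def)
    then show "down_set {..<n} s ` {..<n} = D ` {..<L + 1}" using fst_img by simp
    have "up_set {..<n} s ` {..<n} = U ` (\<lambda>x. snd (I x)) ` {..<n}"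
      unfolding image_image by (rule image_cong) (auto simp: ups U_def)
    then show "up_set {..<n} s ` {..<n} = U ` {..<L + 1}" using snd_img by simp
    show "strict_mono_on {..<L + 1} D"
    proof (rule strict_mono_onI)
      fix i j assume ij: "i \<in> {..<L + 1}" "j \<in> {..<L + 1}" "i < j"
      then obtain x where "x < n" "snd (I x) = i" using right[of i] by auto
      then show "D i < D j" using ij by (auto simp: D_def)
    qed
    show "strict_antimono_on {..<L + 1} U"
    proof (rule strict_antimono_on_setI)
      fix i j assume ij: "i < j" "j < L + 1"
      then obtain x where "x < n" "fst (I x) = j" using left[of j] by auto
      then show "U j \<subset> U i" using ij by (auto simp: U_def)
    qed
    fix x assume "x \<in> {..<n}"
    then show "fst (I x) < L + 1" "snd (I x) < L + 1" "down_set {..<n} s x = D (fst (I x))"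
      "up_set {..<n} s x = U (snd (I x))"
      using le[of x] downs ups by (auto simp: D_def U_def)
  qed
  show thesis using that[of s I] io rep img by (simp add: n_def)
qed

section \<open>Semiorders and nested intervals\<close>

definition unnested :: "(nat \<times> nat) multiset \<Rightarrow> bool" where
  "unnested M \<longleftrightarrow> (\<forall>a b c d. (a, b) \<in># M \<longrightarrow> (c, d) \<in># M \<longrightarrow> \<not> (c < a \<and> b < d))"

lemma unnestedD: "unnested M \<Longrightarrow> (a, b) \<in># M \<Longrightarrow> (c, d) \<in># M \<Longrightarrow> c < a \<Longrightarrow> d \<le> b"
  unfolding unnested_def by (metis not_le)

lemma ex_between_finite:
  fixes A B :: "real set"
  assumes "finite A" "finite B" "\<And>a b. a \<in> A \<Longrightarrow> b \<in> B \<Longrightarrow> a < b"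
  obtains v where "\<And>a. a \<in> A \<Longrightarrow> a < v" "\<And>b. b \<in> B \<Longrightarrow> v < b"
proof (cases "A = {} \<or> B = {}")
  case True
  obtain u w where "\<And>a. a \<in> A \<Longrightarrow> a < u" "\<And>b. b \<in> B \<Longrightarrow> w < b"
  proof
    show "a < Max A + 1" if "a \<in> A" for a using Max_ge[OF assms(1) that] by linarith
    show "Min B - 1 < b" if "b \<in> B" for b using Min_le[OF assms(2) that] by linarith
  qed
  with True that show thesis by (cases "A = {}") auto
next
  case False
  then have "Max A < Min B" using assms by simp
  then obtain v where "Max A < v" "v < Min B" using dense by blast
  then show thesis using that[of v] False assms by simp
qed

text \<open>The Scott--Suppes construction. In a family without nesting, two distinct pairs are comparable in both
  coordinates at once, so ordering by \<open>fst p + snd p\<close> is a linear order. The points are placed on the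
  line in this order. The last point \<open>q\<close> has to lie above all others, more than 1 above those that
  end before \<open>q\<close> starts, and less than 1 above the rest; the invariant for the points already placed puts
  each of these lower bounds below each upper bound.\<close>

lemma ex_unit_representation:
  fixes S :: "(nat \<times> nat) set"
  assumes "finite S" "\<And>p. p \<in> S \<Longrightarrow> fst p \<le> snd p"
    and "\<And>p q. p \<in> S \<Longrightarrow> q \<in> S \<Longrightarrow> \<not> (fst q < fst p \<and> snd p < snd q)"
  shows "\<exists>f :: nat \<times> nat \<Rightarrow> real. \<forall>p\<in>S. \<forall>q\<in>S. snd p < fst q \<longleftrightarrow> f p + 1 < f q"
proof -
  let ?w = "\<lambda>p :: nat \<times> nat. fst p + snd p"
  have "\<exists>f :: nat \<times> nat \<Rightarrow> real. \<forall>p\<in>S. \<forall>q\<in>S. (?w p < ?w q \<longrightarrow> f p < f q) \<and>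
      (snd p < fst q \<longrightarrow> f p + 1 < f q) \<and> (\<not> snd p < fst q \<longrightarrow> f q < f p + 1)"
    using assms
  proof (induction "card S" arbitrary: S)
    case 0
    then show ?case by simp
  next
    case (Suc k)
    from \<open>Suc k = card S\<close> \<open>finite S\<close> have "S \<noteq> {}" by auto
    then have "Max (?w ` S) \<in> ?w ` S" using \<open>finite S\<close> by (intro Max_in) auto
    then obtain q where q: "q \<in> S" "?w q = Max (?w ` S)" by (auto simp del: Max_in)
    have qmax: "?w p \<le> ?w q" if "p \<in> S" for p
      unfolding q(2) using \<open>finite S\<close> that by (intro Max_ge) auto
    have le: "fst p \<le> fst q \<and> snd p \<le> snd q" if "p \<in> S" for p
      using Suc.prems(3)[OF that q(1)] Suc.prems(3)[OF q(1) that] qmax[OF that] by linarith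
    define S' where "S' = S - {q}"
    have S': "finite S'" "k = card S'" "S = insert q S'" "q \<notin> S'"
      using \<open>Suc k = card S\<close> \<open>finite S\<close> q(1) by (auto simp: S'_def)
    have sub: "p \<in> S" if "p \<in> S'" for p using that by (simp add: S'_def)
    have "\<exists>f :: nat \<times> nat \<Rightarrow> real. \<forall>p\<in>S'. \<forall>q\<in>S'. (?w p < ?w q \<longrightarrow> f p < f q) \<and>
      (snd p < fst q \<longrightarrow> f p + 1 < f q) \<and> (\<not> snd p < fst q \<longrightarrow> f q < f p + 1)"
      by (rule Suc.hyps(1)[OF S'(2,1)]) (use Suc.prems(2,3) sub in blast)+
    then obtain f :: "nat \<times> nat \<Rightarrow> real" where f: "\<forall>p\<in>S'. \<forall>q\<in>S'. (?w p < ?w q \<longrightarrow> f p < f q) \<and>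
      (snd p < fst q \<longrightarrow> f p + 1 < f q) \<and> (\<not> snd p < fst q \<longrightarrow> f q < f p + 1)" by blast
    have fw: "f p < f p'" if "p \<in> S'" "p' \<in> S'" "?w p < ?w p'" for p p'
      using f that by blast
    have fn: "f p' < f p + 1" if "p \<in> S'" "p' \<in> S'" "\<not> snd p < fst p'" for p p'
      using f that by blast
    have fb: "f p + 1 < f p'" if "p \<in> S'" "p' \<in> S'" "snd p < fst p'" for p p'
      using f that by blast
    define B where "B = {p \<in> S'. snd p < fst q}"
    define N where "N = {p \<in> S'. \<not> snd p < fst q}"
    \<comment> \<open>\<open>B\<close> are the pairs ending before \<open>q\<close> starts, \<open>N\<close> those that meet \<open>q\<close>.\<close>
    obtain v where v: "\<And>a. a \<in> f ` S' \<union> (\<lambda>p. f p + 1) ` B \<Longrightarrow> a < v"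
      "\<And>b. b \<in> (\<lambda>p. f p + 1) ` N \<Longrightarrow> v < b"
    proof (rule ex_between_finite[of "f ` S' \<union> (\<lambda>p. f p + 1) ` B" "(\<lambda>p. f p + 1) ` N"])
      show "a < b" if a: "a \<in> f ` S' \<union> (\<lambda>p. f p + 1) ` B" and b: "b \<in> (\<lambda>p. f p + 1) ` N" for a b
      proof -
        obtain p' where p': "p' \<in> S'" "\<not> snd p' < fst q" "b = f p' + 1" using b by (auto simp: N_def)
        consider p where "p \<in> S'" "a = f p" | p where "p \<in> S'" "snd p < fst q" "a = f p + 1"
          using a by (auto simp: B_def)
        then show ?thesis
        proof cases
          case (1 p)
          have "\<not> snd p' < fst p" using p' le[OF sub[OF 1(1)]] by linarith
          then show ?thesis using fn[OF p'(1) 1(1)] 1 p' by simp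
        next
          case (2 p)
          have "\<not> (fst p' < fst p \<and> snd p < snd p')" using Suc.prems(3)[OF sub[OF 2(1)] sub[OF p'(1)]] .
          then have "?w p < ?w p'" using 2 p' by linarith
          then show ?thesis using fw[OF 2(1) p'(1)] 2 p' by simp
        qed
      qed
    qed (use S'(1) in \<open>auto simp: B_def N_def\<close>)
    have v1: "f p < v" if "p \<in> S'" for p using v(1) that by blast
    have v2: "f p + 1 < v" if "p \<in> S'" "snd p < fst q" for p using v(1) that unfolding B_def by blast
    have v3: "v < f p + 1" if "p \<in> S'" "\<not> snd p < fst q" for p using v(2) that unfolding N_def by blast
    have "\<forall>p\<in>S. \<forall>p'\<in>S. (?w p < ?w p' \<longrightarrow> (f(q := v)) p < (f(q := v)) p') \<and>
      (snd p < fst p' \<longrightarrow> (f(q := v)) p + 1 < (f(q := v)) p') \<and>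
      (\<not> snd p < fst p' \<longrightarrow> (f(q := v)) p' < (f(q := v)) p + 1)"
    proof (intro ballI)
      fix p p' assume pS: "p \<in> S" "p' \<in> S"
      have qq: "fst q \<le> snd q" using Suc.prems(2) q(1) by blast
      consider "p \<in> S'" "p' \<in> S'" "p \<noteq> q" "p' \<noteq> q" | "p \<in> S'" "p \<noteq> q" "p' = q"
        | "p' \<in> S'" "p' \<noteq> q" "p = q" | "p = q" "p' = q"
        using pS S' by blast
      then show "(?w p < ?w p' \<longrightarrow> (f(q := v)) p < (f(q := v)) p') \<and>
      (snd p < fst p' \<longrightarrow> (f(q := v)) p + 1 < (f(q := v)) p') \<and>
      (\<not> snd p < fst p' \<longrightarrow> (f(q := v)) p' < (f(q := v)) p + 1)"
      proof cases
        case 1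
        then show ?thesis using fw[OF 1(1,2)] fn[OF 1(1,2)] fb[OF 1(1,2)] by simp
      next
        case 2
        then show ?thesis using v1[OF 2(1)] v2[OF 2(1)] v3[OF 2(1)] by simp
      next
        case 3
        have "\<not> ?w q < ?w p'" "\<not> snd q < fst p'"
          using qmax[OF pS(2)] le[OF pS(2)] qq by linarith+
        then show ?thesis using 3 v1[OF 3(1)] by simp
      next
        case 4
        then show ?thesis using qq by simp
      qed
    qed
    then show ?case by blast
  qed
  then obtain f :: "nat \<times> nat \<Rightarrow> real" where f: "\<forall>p\<in>S. \<forall>q\<in>S. (?w p < ?w q \<longrightarrow> f p < f q) \<and>
      (snd p < fst q \<longrightarrow> f p + 1 < f q) \<and> (\<not> snd p < fst q \<longrightarrow> f q < f p + 1)" by blast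
  have "snd p < fst q \<longleftrightarrow> f p + 1 < f q" if "p \<in> S" "q \<in> S" for p q
    using bspec[OF bspec[OF f that(1)] that(2)] by (meson less_asym)
  then show ?thesis by blast
qed

text \<open>If \<open>[a, b]\<close> lies in the interior of \<open>[c, d]\<close>, take an interval ending at \<open>c\<close> and one starting at
  \<open>d\<close>: with \<open>[a, b]\<close> between them they form a chain of three, and all of it is incomparable to
  \<open>[c, d]\<close>. Then \<open>[c, d]\<close> needs to be longer than \<open>[a, b]\<close> in every real representation. The converse is
  the unit interval construction.\<close>

lemma semiorder_iff_unnested:
  assumes P: "poset X r" and rep: "minimal_endpoint_rep X r I"
    and c: "canonical L (image_mset I (mset_set X))"
  shows "semiorder X r \<longleftrightarrow> unnested (image_mset I (mset_set X))"
proof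
  let ?M = "image_mset I (mset_set X)"
  have fin: "finite X" using P by (simp add: poset_def)
  have mem: "p \<in># ?M \<longleftrightarrow> (\<exists>x\<in>X. I x = p)" for p using fin by auto
  note below = strictly_below_iff_endpoints[OF P rep]
  {
    assume "semiorder X r"
    then obtain lft rgt k where real: "real_interval_rep X r lft rgt" and k: "\<And>x. x \<in> X \<Longrightarrow> rgt x - lft x = k"
      unfolding semiorder_def by blast
    have rl: "strictly_below r x y \<longleftrightarrow> rgt x < lft y" if "x \<in> X" "y \<in> X" for x y
      using real that unfolding real_interval_rep_def by blast
    show "unnested ?M"
      unfolding unnested_def
    proof (intro allI impI notI)
      fix a b c' d
      assume "(a, b) \<in># ?M" "(c', d) \<in># ?M" and nest: "c' < a \<and> b < d"
      then obtain x w where x: "x \<in> X" "I x = (a, b)" and w: "w \<in> X" "I w = (c', d)"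
        using mem by meson
      have "d \<le> L" "c' \<le> d" using canonicalD[OF c \<open>(c', d) \<in># ?M\<close>] by auto
      then obtain a' b' where "(a', c') \<in># ?M" "(d, b') \<in># ?M" and le: "a' \<le> c'" "d \<le> b'"
        using canonical_right[OF c, of c'] canonical_left[OF c, of d] by (metis le_trans)
      then obtain u v where u: "u \<in> X" "I u = (a', c')" and v: "v \<in> X" "I v = (d, b')"
        using mem by meson
      have "strictly_below r u x" "strictly_below r x v" "\<not> strictly_below r u w" "\<not> strictly_below r w v"
        using nest by (simp_all add: below u x v w)
      then have "rgt u < lft x" "rgt x < lft v" "lft w \<le> rgt u" "lft v \<le> rgt w"
        using rl u v w x by auto
      then show False using k[OF x(1)] k[OF w(1)] by linarith
    qed
  }
  {
    assume un: "unnested ?M"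
    have "\<exists>f :: nat \<times> nat \<Rightarrow> real. \<forall>p\<in>set_mset ?M. \<forall>q\<in>set_mset ?M. snd p < fst q \<longleftrightarrow> f p + 1 < f q"
    proof (rule ex_unit_representation)
      show "fst p \<le> snd p" if "p \<in># ?M" for p
        using canonicalD(1)[OF c, of "fst p" "snd p"] that by simp
      show "\<not> (fst q < fst p \<and> snd p < snd q)" if "p \<in># ?M" "q \<in># ?M" for p q
        using unnestedD[OF un, of "fst p" "snd p" "fst q" "snd q"] that by auto
    qed (rule finite_set_mset)
    then obtain f :: "nat \<times> nat \<Rightarrow> real"
      where f: "\<forall>p\<in>set_mset ?M. \<forall>q\<in>set_mset ?M. snd p < fst q \<longleftrightarrow> f p + 1 < f q" by blast
    have "real_interval_rep X r (\<lambda>x. f (I x)) (\<lambda>x. f (I x) + 1)"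
      unfolding real_interval_rep_def
    proof (intro conjI ballI)
      fix x y assume "x \<in> X" "y \<in> X"
      then show "strictly_below r x y \<longleftrightarrow> f (I x) + 1 < f (I y)"
        using below f mem by metis
    qed simp
    then show "semiorder X r" unfolding semiorder_def using P
      by (intro conjI exI[of _ "\<lambda>x. f (I x)"] exI[of _ "\<lambda>x. f (I x) + 1"] exI[of _ 1]) simp_all
  }
qed

section \<open>Hereditary semiorders as sequences\<close>

lemma Psi_eq_semiorder_iff:
  assumes "Psi_eq X r xs"
  shows "semiorder X r \<longleftrightarrow> unnested (Psi_inv_rep xs)"
proof -
  obtain I where P: "poset X r" and xs: "ascent_sequence xs" and rep: "minimal_endpoint_rep X r I"
    and img: "image_mset I (mset_set X) = Psi_inv_rep xs"
    using assms unfolding Psi_eq_def interval_order_def by blast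
  show ?thesis
    using semiorder_iff_unnested[OF P rep] canonical_Psi_inv_rep(1)[OF xs] unfolding img .
qed

lemma Psi_eq_iso_iff:
  assumes "Psi_eq X r xs" "Psi_eq Y s ys"
  shows "poset_iso X r Y s \<longleftrightarrow> xs = ys"
proof -
  obtain I where X: "poset X r" "minimal_endpoint_rep X r I" "ascent_sequence xs"
    and I: "image_mset I (mset_set X) = Psi_inv_rep xs"
    using assms(1) unfolding Psi_eq_def interval_order_def by blast
  obtain J where Y: "poset Y s" "minimal_endpoint_rep Y s J" "ascent_sequence ys"
    and J: "image_mset J (mset_set Y) = Psi_inv_rep ys"
    using assms(2) unfolding Psi_eq_def interval_order_def by blast
  have "poset_iso X r Y s \<longleftrightarrow> Psi_inv_rep xs = Psi_inv_rep ys"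
    using minimal_endpoint_rep_poset_iso[OF X(2) Y(2)] poset_iso_if_endpoints_eq[OF X(1,2) Y(1,2)]
    unfolding I J by blast
  also have "\<dots> \<longleftrightarrow> xs = ys" using inj_on_eq_iff[OF inj_on_Psi_inv_rep] X(3) Y(3) by simp
  finally show ?thesis .
qed

lemma ex_Psi_eq:
  assumes "ascent_sequence xs"
  shows "\<exists>s. Psi_eq {..<length xs} s xs"
  using ex_interval_order_canonical[OF canonical_Psi_inv_rep(1)[OF assms]]
  unfolding canonical_Psi_inv_rep(3)[OF assms] Psi_eq_def using assms by (metis card_lessThan)

lemma ascent_sequence_take:
  assumes "ascent_sequence xs" "1 \<le> i"
  shows "ascent_sequence (take i xs)"
  using assms unfolding ascent_sequence_def by (auto simp: min_def)

definition hereditary_sequence :: "nat list \<Rightarrow> bool" where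
  "hereditary_sequence xs \<longleftrightarrow> ascent_sequence xs \<and>
     (\<forall>i\<in>{1..length xs}. unnested (Psi_inv_rep (take i xs)))"

lemma hereditary_semiorder_iff:
  assumes "finite X" "X \<noteq> {}"
  shows "hereditary_semiorder X r \<longleftrightarrow> (\<exists>xs. Psi_eq X r xs \<and> hereditary_sequence xs)"
proof
  assume "hereditary_semiorder X r"
  then obtain xs where xs: "Psi_eq X r xs"
    and pre: "\<forall>i\<in>{1..card X}. \<exists>s :: nat rel. Psi_eq {..<i} s (take i xs) \<and> semiorder {..<i} s"
    unfolding hereditary_semiorder_def by blast
  have "length xs = card X" "ascent_sequence xs" using xs by (auto simp: Psi_eq_def)
  then have "hereditary_sequence xs"
    unfolding hereditary_sequence_def using pre Psi_eq_semiorder_iff by metis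
  then show "\<exists>xs. Psi_eq X r xs \<and> hereditary_sequence xs" using xs by blast
next
  assume "\<exists>xs. Psi_eq X r xs \<and> hereditary_sequence xs"
  then obtain xs where xs: "Psi_eq X r xs" and h: "hereditary_sequence xs" by blast
  have len: "length xs = card X" and asc: "ascent_sequence xs" using xs by (auto simp: Psi_eq_def)
  have card: "1 \<le> card X" using assms by (simp add: Suc_le_eq card_gt_0_iff)
  have un: "unnested (Psi_inv_rep (take i xs))" if "i \<in> {1..card X}" for i
    using h that len unfolding hereditary_sequence_def by simp
  have "\<exists>s :: nat rel. Psi_eq {..<i} s (take i xs) \<and> semiorder {..<i} s" if i: "i \<in> {1..card X}" for i
  proof -
    have "ascent_sequence (take i xs)" using ascent_sequence_take[OF asc] i by simp
    moreover have "length (take i xs) = i" using i len by simp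
    ultimately obtain s where s: "Psi_eq {..<i} s (take i xs)" using ex_Psi_eq by metis
    then show ?thesis using Psi_eq_semiorder_iff[OF s] un[OF i] by blast
  qed
  moreover have "semiorder X r" using Psi_eq_semiorder_iff[OF xs] un[of "card X"] card len by simp
  ultimately show "hereditary_semiorder X r" unfolding hereditary_semiorder_def using xs by blast
qed

lemma poset_iso_refl: "poset_iso X r X r"
  unfolding poset_iso_def by (intro exI[of _ id]) simp

lemma poset_iso_sym:
  assumes "poset_iso X r Y s"
  shows "poset_iso Y s X r"
proof -
  obtain f where f: "bij_betw f X Y" "\<And>x y. x \<in> X \<Longrightarrow> y \<in> X \<Longrightarrow> (x, y) \<in> r \<longleftrightarrow> (f x, f y) \<in> s"
    using assms unfolding poset_iso_def by blast
  have g: "inv_into X f y \<in> X" "f (inv_into X f y) = y" if "y \<in> Y" for y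
    using f(1) that by (auto simp: bij_betw_def inv_into_into f_inv_into_f)
  show ?thesis unfolding poset_iso_def
    by (intro exI[of _ "inv_into X f"] conjI bij_betw_inv_into[OF f(1)]) (simp add: f(2) g)
qed

lemma poset_iso_trans:
  assumes "poset_iso X r Y s" "poset_iso Y s Z t"
  shows "poset_iso X r Z t"
proof -
  obtain f where f: "bij_betw f X Y" "\<And>x y. x \<in> X \<Longrightarrow> y \<in> X \<Longrightarrow> (x, y) \<in> r \<longleftrightarrow> (f x, f y) \<in> s"
    using assms(1) unfolding poset_iso_def by blast
  obtain g where g: "bij_betw g Y Z" "\<And>x y. x \<in> Y \<Longrightarrow> y \<in> Y \<Longrightarrow> (x, y) \<in> s \<longleftrightarrow> (g x, g y) \<in> t"
    using assms(2) unfolding poset_iso_def by blast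
  have fY: "f x \<in> Y" if "x \<in> X" for x using f(1) that by (auto simp: bij_betw_def)
  show ?thesis unfolding poset_iso_def
    by (intro exI[of _ "g \<circ> f"] conjI bij_betw_trans[OF f(1) g(1)]) (simp add: f(2) g(2) fY)
qed

lemma equiv_poset_iso_rel: "equiv {r. poset {..<n} r} (poset_iso_rel n)"
proof (rule equivI)
  show "poset_iso_rel n \<subseteq> {r. poset {..<n} r} \<times> {r. poset {..<n} r}"
    by (auto simp: poset_iso_rel_def)
  show "refl_on {r. poset {..<n} r} (poset_iso_rel n)"
    by (rule refl_onI) (simp add: poset_iso_rel_def poset_iso_refl)
  show "sym (poset_iso_rel n)"
    by (rule symI) (simp add: poset_iso_rel_def poset_iso_sym)
  show "trans (poset_iso_rel n)"
    by (rule transI) (auto simp: poset_iso_rel_def intro: poset_iso_trans)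
qed

lemma card_image_eq_card_image:
  assumes "\<And>x y. x \<in> A \<Longrightarrow> y \<in> A \<Longrightarrow> f x = f y \<longleftrightarrow> g x = g y"
  shows "card (f ` A) = card (g ` A)"
proof -
  have eq: "f (inv_into A g (g x)) = f x" if "x \<in> A" for x
    using assms that by (meson f_inv_into_f imageI inv_into_into)
  have "f ` A = (\<lambda>z. f (inv_into A g z)) ` g ` A"
    unfolding image_image by (rule image_cong) (simp_all add: eq)
  moreover have "inj_on (\<lambda>z. f (inv_into A g z)) (g ` A)"
    by (rule inj_onI) (auto simp: eq assms)
  ultimately show ?thesis by (simp add: card_image)
qed

text \<open>Two hereditary semiorders are isomorphic iff they have the same ascent sequence, so the isomorphism
  classes are the fibres of the map \<open>\<phi>\<close> below.\<close>

lemma num_hereditary_eq_card_sequences: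
  assumes "n \<ge> 1"
  shows "num_hereditary n = card {xs. length xs = n \<and> hereditary_sequence xs}"
proof -
  define A where "A = {r. hereditary_semiorder {..<n} r}"
  define \<phi> where "\<phi> r = (SOME xs. Psi_eq {..<n} r xs)" for r
  have ne: "{..<n} \<noteq> {}" using assms by (simp add: lessThan_empty_iff)
  note her = hereditary_semiorder_iff[OF finite_lessThan ne]
  have \<phi>_eq: "\<phi> r = xs" if "Psi_eq {..<n} r xs" for r xs
    unfolding \<phi>_def
    by (rule some_equality, rule that) (use Psi_eq_iso_iff[OF _ that] poset_iso_refl in blast)
  have A: "\<exists>xs. Psi_eq {..<n} r xs \<and> hereditary_sequence xs \<and> \<phi> r = xs" if "r \<in> A" for r
    using that her \<phi>_eq by (auto simp: A_def)
  have posetA: "r \<in> {r. poset {..<n} r}" if "r \<in> A" for r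
    using A[OF that] by (auto simp: Psi_eq_def interval_order_def)
  have "A // poset_iso_rel n = (\<lambda>r. poset_iso_rel n `` {r}) ` A"
    by (auto simp: quotient_def)
  then have "num_hereditary n = card ((\<lambda>r. poset_iso_rel n `` {r}) ` A)"
    by (simp add: num_hereditary_def A_def)
  also have "\<dots> = card (\<phi> ` A)"
  proof (rule card_image_eq_card_image)
    fix r s assume rs: "r \<in> A" "s \<in> A"
    have "poset_iso_rel n `` {r} = poset_iso_rel n `` {s} \<longleftrightarrow> (r, s) \<in> poset_iso_rel n"
      by (rule eq_equiv_class_iff[OF equiv_poset_iso_rel posetA[OF rs(1)] posetA[OF rs(2)]])
    also have "\<dots> \<longleftrightarrow> poset_iso {..<n} r {..<n} s"
      using posetA[OF rs(1)] posetA[OF rs(2)] by (simp add: poset_iso_rel_def)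
    also have "\<dots> \<longleftrightarrow> \<phi> r = \<phi> s" using A[OF rs(1)] A[OF rs(2)] Psi_eq_iso_iff by metis
    finally show "poset_iso_rel n `` {r} = poset_iso_rel n `` {s} \<longleftrightarrow> \<phi> r = \<phi> s" .
  qed
  also have "\<phi> ` A = {xs. length xs = n \<and> hereditary_sequence xs}"
  proof (intro subset_antisym subsetI)
    fix xs assume "xs \<in> \<phi> ` A"
    then show "xs \<in> {xs. length xs = n \<and> hereditary_sequence xs}"
      using A by (auto simp: Psi_eq_def)
  next
    fix xs assume xs: "xs \<in> {xs. length xs = n \<and> hereditary_sequence xs}"
    then obtain s where s: "Psi_eq {..<n} s xs"
      using ex_Psi_eq[of xs] by (auto simp: hereditary_sequence_def)
    then have "s \<in> A" using xs her by (auto simp: A_def)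
    then show "xs \<in> \<phi> ` A" using \<phi>_eq[OF s] by blast
  qed
  finally show ?thesis .
qed

section \<open>Appending entries\<close>

text \<open>The lists that extend an ascent sequence with representation \<open>M\<close> while all further
  prefixes stay semiorders.\<close>

fun hereditary_extension :: "(nat \<times> nat) multiset \<Rightarrow> nat list \<Rightarrow> bool" where
  "hereditary_extension M [] \<longleftrightarrow> True"
| "hereditary_extension M (i # ys) \<longleftrightarrow> i \<le> max_right M + 1 \<and> unnested (insert_interval M i) \<and>
     hereditary_extension (insert_interval M i) ys"

lemma hereditary_sequence_prefix:
  assumes "hereditary_sequence (xs @ ys)" "xs \<noteq> []"
  shows "hereditary_sequence xs"
proof -
  have asc: "ascent_sequence (xs @ ys)" 
    and un: "\<And>i. i \<in> {1..length (xs @ ys)} \<Longrightarrow> unnested (Psi_inv_rep (take i (xs @ ys)))"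
    using assms(1) by (auto simp: hereditary_sequence_def)
  have "ascent_sequence xs" using ascent_sequence_take[OF asc, of "length xs"] assms(2) by (simp add: Suc_le_eq)
  moreover have "unnested (Psi_inv_rep (take i xs))" if "i \<in> {1..length xs}" for i
    using un[of i] that by simp
  ultimately show ?thesis by (simp add: hereditary_sequence_def)
qed

lemma hereditary_sequence_snoc:
  assumes "hereditary_sequence xs"
  shows "hereditary_sequence (xs @ [x]) \<longleftrightarrow>
    x \<le> max_right (Psi_inv_rep xs) + 1 \<and> unnested (insert_interval (Psi_inv_rep xs) x)"
proof -
  have asc: "ascent_sequence xs" using assms by (simp add: hereditary_sequence_def)
  then have ne: "xs \<noteq> []" by (auto simp: ascent_sequence_def)
  have "{1..length (xs @ [x])} = insert (length xs + 1) {1..length xs}" by auto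
  moreover have "unnested (Psi_inv_rep (take i (xs @ [x])))" if "i \<in> {1..length xs}" for i
    using assms that by (simp add: hereditary_sequence_def)
  ultimately show ?thesis
    using asc unfolding hereditary_sequence_def ascent_sequence_snoc[OF ne]
      max_right_canonical[OF canonical_Psi_inv_rep(1)[OF asc]]
    by (auto simp: Psi_inv_rep_snoc[OF ne])
qed

lemma hereditary_sequence_append:
  assumes "hereditary_sequence xs"
  shows "hereditary_sequence (xs @ ys) \<longleftrightarrow> hereditary_extension (Psi_inv_rep xs) ys"
  using assms
proof (induction ys arbitrary: xs)
  case Nil
  then show ?case by simp
next
  case (Cons y ys)
  have ne: "xs \<noteq> []" using Cons.prems by (auto simp: hereditary_sequence_def ascent_sequence_def)
  show ?case
  proof (cases "hereditary_sequence (xs @ [y])")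
    case True
    then show ?thesis
      using Cons.IH[OF True] hereditary_sequence_snoc[OF Cons.prems, of y] by (simp add: Psi_inv_rep_snoc[OF ne])
  next
    case False
    then have "\<not> hereditary_sequence (xs @ y # ys)"
      using hereditary_sequence_prefix[of "xs @ [y]" ys] by auto
    then show ?thesis using False hereditary_sequence_snoc[OF Cons.prems, of y] by auto
  qed
qed

definition legal_entries :: "(nat \<times> nat) multiset \<Rightarrow> nat set" where
  "legal_entries M = {i. i \<le> max_right M + 1 \<and> unnested (insert_interval M i)}"

definition extensions :: "(nat \<times> nat) multiset \<Rightarrow> nat \<Rightarrow> nat list set" where
  "extensions M k = {ys. length ys = k \<and> hereditary_extension M ys}"

lemma finite_legal_entries: "finite (legal_entries M)"
  unfolding legal_entries_def by (rule finite_subset[of _ "{..max_right M + 1}"]) auto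

lemma extensions_0: "extensions M 0 = {[]}"
  by (auto simp: extensions_def)

lemma extensions_Suc:
  "extensions M (Suc k) = (\<Union>i\<in>legal_entries M. (#) i ` extensions (insert_interval M i) k)"
proof (rule set_eqI)
  fix ys show "ys \<in> extensions M (Suc k) \<longleftrightarrow> ys \<in> (\<Union>i\<in>legal_entries M. (#) i ` extensions (insert_interval M i) k)"
    by (cases ys) (auto simp: extensions_def legal_entries_def)
qed

lemma finite_extensions: "finite (extensions M k)"
  by (induction k arbitrary: M) (simp_all add: extensions_0 extensions_Suc finite_legal_entries)

lemma card_extensions_Suc:
  "card (extensions M (Suc k)) = (\<Sum>i\<in>legal_entries M. card (extensions (insert_interval M i) k))"
proof -
  have "card (extensions M (Suc k)) = (\<Sum>i\<in>legal_entries M. card ((#) i ` extensions (insert_interval M i) k))"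
    unfolding extensions_Suc
    by (rule card_UN_disjoint) (auto simp: finite_legal_entries finite_extensions)
  also have "\<dots> = (\<Sum>i\<in>legal_entries M. card (extensions (insert_interval M i) k))"
    by (intro sum.cong refl card_image) simp
  finally show ?thesis .
qed

lemma num_hereditary_eq_card_extensions:
  "num_hereditary (Suc k) = card (extensions {#(0, 0)#} k)"
proof -
  have h0: "hereditary_sequence [0]"
    by (simp add: hereditary_sequence_def ascent_sequence_singleton Psi_inv_rep_singleton unnested_def)
  have h: "hereditary_sequence (x # ys) \<longleftrightarrow> x = 0 \<and> hereditary_extension {#(0, 0)#} ys" for x ys
  proof (cases "x = 0")
    case True
    then show ?thesis using hereditary_sequence_append[OF h0, of ys] by (simp add: Psi_inv_rep_singleton)
  next
    case False
    then show ?thesis by (auto simp: hereditary_sequence_def ascent_sequence_def)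
  qed
  have "{xs. length xs = Suc k \<and> hereditary_sequence xs} = (#) 0 ` extensions {#(0, 0)#} k"
    by (auto simp: h extensions_def length_Suc_conv)
  then show ?thesis
    using num_hereditary_eq_card_sequences[of "Suc k"] by (simp add: card_image)
qed

section \<open>Which entries keep a semiorder\<close>

text \<open>Here \<open>m\<close> is the largest left endpoint of an interval that ends before \<open>L\<close>; such an interval exists
  as soon as \<open>L > 0\<close>. The left endpoint \<open>l - 1\<close>, if any, belongs to an interval that ends before \<open>L\<close>, and no
  interval starting after \<open>l\<close> does, so \<open>m\<close> is \<open>l\<close> or \<open>l - 1\<close>. The flag \<open>g\<close> decides
  whether the intervals ending strictly between \<open>m\<close> and \<open>L\<close>, stretched by a Move 3 with
  \<open>i = m + 1 < L\<close>, avoid having another interval in their interior; it is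
  recorded also when \<open>m < l\<close>, since a Move 1 with \<open>i = m\<close> makes \<open>m\<close> the new \<open>l\<close>.\<close>

definition profile :: "nat \<Rightarrow> nat \<Rightarrow> nat \<Rightarrow> bool \<Rightarrow> (nat \<times> nat) multiset \<Rightarrow> bool" where
  "profile L l m g M \<longleftrightarrow> canonical L M \<and> unnested M \<and> min_left_of_max_right M = l \<and>
     (l = m \<or> l = m + 1) \<and> (\<exists>b<L. (m, b) \<in># M) \<and>
     (\<forall>a b. (a, b) \<in># M \<longrightarrow> b < L \<longrightarrow> a \<le> m) \<and>
     (g \<longleftrightarrow> (\<forall>a b. (a, b) \<in># M \<longrightarrow> m < b \<longrightarrow> b < L \<longrightarrow> a = m))"

context
  fixes L l m :: nat and g :: bool and M :: "(nat \<times> nat) multiset"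
  assumes profile: "profile L l m g M"
begin

lemma profile_canonical: "canonical L M" and profile_unnested: "unnested M"
  and profile_min_left: "min_left_of_max_right M = l" and profile_diff: "l = m \<or> l = m + 1"
  and profile_witness: "\<exists>b<L. (m, b) \<in># M"
  and profile_left_le: "(a, b) \<in># M \<Longrightarrow> b < L \<Longrightarrow> a \<le> m"
  and profile_flag: "g \<longleftrightarrow> (\<forall>a b. (a, b) \<in># M \<longrightarrow> m < b \<longrightarrow> b < L \<longrightarrow> a = m)"
  using profile unfolding profile_def by blast+

lemma profile_le: "a \<le> b" "b \<le> L" if "(a, b) \<in># M"
  using canonicalD[OF profile_canonical that] .

lemma profile_min_left_mem: "(l, L) \<in># M"
  using min_left_props(1)[OF profile_canonical] profile_min_left by simp

lemma profile_min_left_le: "(a, L) \<in># M \<Longrightarrow> l \<le> a"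
  using min_left_props(2)[OF profile_canonical] profile_min_left by simp

lemma profile_bounds: "l \<le> L" "m \<le> l" "m < L"
proof -
  obtain b where "b < L" "(m, b) \<in># M" using profile_witness by blast
  then show "m < L" using profile_le(1) by fastforce
qed (use profile_le[OF profile_min_left_mem] profile_diff in auto)

lemma profile_right_eq: "b = L" if "(a, b) \<in># M" "l < a"
  using profile_left_le[OF that(1)] profile_le[OF that(1)] profile_bounds that(2) by linarith

lemma profile_mem_right: "(a, L) \<in># M" if "l \<le> a" "a \<le> L"
proof (cases "a = l")
  case False
  obtain b where "(a, b) \<in># M" using canonical_left[OF profile_canonical \<open>a \<le> L\<close>] by blast
  moreover from this have "b = L" using profile_right_eq that False by simp
  ultimately show ?thesis by simp
qed (simp add: profile_min_left_mem)

lemma mem_profile_move1: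
  assumes "i \<le> l"
  shows "(p, q) \<in># insert_interval M i \<longleftrightarrow> p = i \<and> q = L \<or> (p, q) \<in># M"
  using insert_interval_move1[OF profile_canonical, of i] assms profile_min_left by auto

text \<open>The new interval \<open>[i, L]\<close> has the largest right endpoint, so it can only be the outer one of a
  nested pair, and the inner one would end before \<open>L\<close> and start after \<open>i\<close>.\<close>

lemma unnested_profile_move1:
  assumes "i \<le> l"
  shows "unnested (insert_interval M i) \<longleftrightarrow> m \<le> i"
proof
  assume un: "unnested (insert_interval M i)"
  obtain b where b: "b < L" "(m, b) \<in># M" using profile_witness by blast
  have "(i, L) \<in># insert_interval M i" "(m, b) \<in># insert_interval M i"
    using b mem_profile_move1[OF assms] by auto
  then show "m \<le> i" using unnestedD[OF un, of m b i L] b by linarith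
next
  assume mi: "m \<le> i"
  show "unnested (insert_interval M i)"
    unfolding unnested_def mem_profile_move1[OF assms]
  proof (intro allI impI notI)
    fix a b c d
    assume ab: "a = i \<and> b = L \<or> (a, b) \<in># M" and cd: "c = i \<and> d = L \<or> (c, d) \<in># M"
      and nest: "c < a \<and> b < d"
    have "d \<le> L" using cd profile_le by auto
    then have ab': "(a, b) \<in># M" "b < L" using ab nest by auto
    then have "a \<le> m" by (rule profile_left_le)
    then have "(c, d) \<in># M" using cd nest mi by auto
    then show False using unnestedD[OF profile_unnested ab'(1)] nest by fastforce
  qed
qed

lemma profile_move1:
  assumes "m \<le> i" "i \<le> l"
  shows "profile L i m g (insert_interval M i)"
proof -
  note mem = mem_profile_move1[OF assms(2)]
  have i: "i \<le> min_left_of_max_right M" using assms(2) profile_min_left by simp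
  have 1: "canonical L (insert_interval M i)" "min_left_of_max_right (insert_interval M i) = i"
    using canonical_move1[OF profile_canonical i] by auto
  have 2: "unnested (insert_interval M i)" using unnested_profile_move1[OF assms(2)] assms(1) by blast
  have 3: "i = m \<or> i = m + 1" using assms profile_diff by linarith
  have 4: "\<exists>b<L. (m, b) \<in># insert_interval M i" using profile_witness mem by blast
  have 5: "\<forall>a b. (a, b) \<in># insert_interval M i \<longrightarrow> b < L \<longrightarrow> a \<le> m"
    unfolding mem using profile_left_le by blast
  have 6: "g \<longleftrightarrow> (\<forall>a b. (a, b) \<in># insert_interval M i \<longrightarrow> m < b \<longrightarrow> b < L \<longrightarrow> a = m)"
    unfolding mem profile_flag by blast
  show ?thesis unfolding profile_def using 1 2 3 4 5 6 by blast
qed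

text \<open>In an unnested multiset all intervals starting after \<open>l\<close> end at \<open>L\<close>, and every
  \<open>[a, L]\<close> with \<open>l \<le> a \<le> L\<close> occurs. So the shifted and the cut intervals of Move 3 are known explicitly.\<close>

lemma mem_profile_move3:
  assumes "l < i" "i \<le> L"
  shows "(p, q) \<in># insert_interval M i \<longleftrightarrow>
    i \<le> p \<and> p \<le> L + 1 \<and> q = L + 1 \<or>
    p < i \<and> q < i \<and> (p, q) \<in># M \<or>
    p < i \<and> i < q \<and> q \<le> L \<and> (p, q - 1) \<in># M \<or>
    p < i \<and> q = i \<and> l \<le> p"
proof -
  have "(p = i \<and> q = L + 1 \<or> (\<exists>a b. (a, b) \<in># M \<and> i \<le> a \<and> p = a + 1 \<and> q = b + 1)) \<longleftrightarrow>
      i \<le> p \<and> p \<le> L + 1 \<and> q = L + 1" (is "?A \<longleftrightarrow> ?B")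
  proof
    assume ?A
    then consider "p = i" "q = L + 1" | a b where "(a, b) \<in># M" "i \<le> a" "p = a + 1" "q = b + 1" by blast
    then show ?B
    proof cases
      case (2 a b)
      then have "b = L" "a \<le> L" using profile_right_eq[OF 2(1)] profile_le[OF 2(1)] assms by auto
      then show ?thesis using 2 by simp
    qed (use assms in simp)
  next
    assume B: ?B
    show ?A
    proof (cases "p = i")
      case False
      then have "i \<le> p - 1" "p - 1 \<le> L" "p = (p - 1) + 1" using B by auto
      moreover have "(p - 1, L) \<in># M" using profile_mem_right[of "p - 1"] calculation assms by linarith
      ultimately show ?thesis using B by blast
    qed (use B in simp)
  qed
  moreover have "(p, L) \<in># M \<longleftrightarrow> l \<le> p" if "p < i"
    using profile_mem_right[of p] profile_min_left_le[of p] that assms by auto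
  moreover have "min_left_of_max_right M < i" using assms profile_min_left by simp
  ultimately show ?thesis unfolding mem_move3[OF profile_canonical \<open>min_left_of_max_right M < i\<close> assms(2)] by blast
qed

text \<open>Move 3 cuts \<open>[i - 1, L]\<close> to \<open>[i - 1, i]\<close> and stretches the intervals \<open>[a, b]\<close> with \<open>i \<le> b < L\<close> past
  \<open>i\<close>. Unless \<open>i = L\<close> there is such an interval, and it must not start before \<open>i - 1\<close>. Since
  \<open>a \<le> m \<le> l \<le> i - 1\<close>, this forces \<open>a = m = l = i - 1\<close> for all of them, which is the flag \<open>g\<close>.\<close>

lemma unnested_profile_move3:
  assumes "l < i" "i \<le> L"
  shows "unnested (insert_interval M i) \<longleftrightarrow> i = L \<or> i = l + 1 \<and> m = l \<and> g"
proof
  note mem = mem_profile_move3[OF assms]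
  assume un: "unnested (insert_interval M i)"
  show "i = L \<or> i = l + 1 \<and> m = l \<and> g"
  proof (cases "i = L")
    case False
    have left_eq: "a = m \<and> m = l \<and> i = l + 1" if ab: "(a, b) \<in># M" "i \<le> b" "b < L" for a b
    proof -
      have am: "a \<le> m" using profile_left_le[OF ab(1,3)] .
      then have ai: "a < i" using profile_bounds assms by linarith
      have "(a, b + 1) \<in># insert_interval M i" unfolding mem using ab ai by simp
      moreover have "(i - 1, i) \<in># insert_interval M i" unfolding mem using assms by simp
      ultimately have "\<not> (a < i - 1 \<and> i < b + 1)" using un unfolding unnested_def by blast
      then show ?thesis using am ab profile_bounds assms by linarith
    qed
    have "L - 1 \<le> L" by simp
    then obtain a where "(a, L - 1) \<in># M" using canonical_right[OF profile_canonical] by blast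
    then have ml: "m = l \<and> i = l + 1" using left_eq[of a "L - 1"] False assms by linarith
    have g unfolding profile_flag
    proof (intro allI impI)
      fix a b assume "(a, b) \<in># M" "m < b" "b < L"
      then show "a = m" using left_eq[of a b] ml by simp
    qed
    then show ?thesis using ml by simp
  qed simp
next
  note mem = mem_profile_move3[OF assms]
  assume i: "i = L \<or> i = l + 1 \<and> m = l \<and> g"
  \<comment> \<open>Every stretched interval starts at \<open>l = i - 1\<close>.\<close>
  have stretched: "p = l \<and> i = l + 1 \<and> m = l" if "i < q" "q \<le> L" "(p, q - 1) \<in># M" for p q
  proof -
    have i': "i = l + 1" "m = l" g using i that by auto
    have "m < q - 1" "q - 1 < L" using that i' by auto
    then have "p = m" using that(3) \<open>g\<close> unfolding profile_flag by blast
    then show ?thesis using i' by simp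
  qed
  have low: "p \<le> m" if "q < i" "(p, q) \<in># M" for p q
    using profile_left_le[OF that(2)] that(1) assms by linarith
  show "unnested (insert_interval M i)"
    unfolding unnested_def
  proof (intro allI impI notI)
    fix p q p' q'
    assume inner: "(p, q) \<in># insert_interval M i" and outer: "(p', q') \<in># insert_interval M i"
      and nest: "p' < p \<and> q < q'"
    have "q' \<le> L + 1" using outer assms unfolding mem by linarith
    consider (top) "i \<le> p" "q = L + 1" | (old) "p < i" "q < i" "(p, q) \<in># M"
      | (str) "p < i" "i < q" "q \<le> L" "(p, q - 1) \<in># M" | (cut) "p < i" "q = i" "l \<le> p"
      using inner unfolding mem by blast
    then show False
    proof cases
      case top
      then show ?thesis using nest \<open>q' \<le> L + 1\<close> by simp
    next
      case old
      consider "i \<le> p'" | "(p', q') \<in># M" | "i < q'" "q' \<le> L" "(p', q' - 1) \<in># M" | "l \<le> p'"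
        using outer unfolding mem by blast
      then show ?thesis
      proof cases
        case 1
        then show ?thesis using old nest by simp
      next
        case 2
        then show ?thesis using unnestedD[OF profile_unnested old(3) 2] nest by simp
      next
        case 3
        then show ?thesis using stretched[OF 3] low[OF old(2,3)] nest by simp
      next
        case 4
        then show ?thesis using low[OF old(2,3)] nest profile_bounds by simp
      qed
    next
      case str
      then have "p = l \<and> i = l + 1 \<and> m = l" using stretched by blast
      moreover consider "i \<le> p'" | "q' \<le> i" | "i < q'" "q' \<le> L" "(p', q' - 1) \<in># M"
        using outer unfolding mem by fastforce
      ultimately show ?thesis using stretched[of q' p'] str nest by cases auto
    next
      case cut
      consider "i \<le> p'" | "q' \<le> i" | "i < q'" "q' \<le> L" "(p', q' - 1) \<in># M"
        using outer unfolding mem by fastforce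
      then show ?thesis using stretched[of q' p'] cut nest by cases auto
    qed
  qed
qed

lemma profile_move3_last:
  assumes "l < L"
  shows "profile (L + 1) L (L - 1) (l = L - 1) (insert_interval M L)"
proof -
  note mem = mem_profile_move3[OF assms le_refl]
  have "min_left_of_max_right M < L" using assms profile_min_left by simp
  from canonical_move3[OF profile_canonical this le_refl]
  have 1: "canonical (L + 1) (insert_interval M L)" "min_left_of_max_right (insert_interval M L) = L" by auto
  have 2: "unnested (insert_interval M L)" using unnested_profile_move3[OF assms le_refl] by simp
  have 3: "L = L - 1 \<or> L = L - 1 + 1" using assms by simp
  have "(L - 1, L) \<in># insert_interval M L" unfolding mem using assms by simp
  then have 4: "\<exists>b<L + 1. (L - 1, b) \<in># insert_interval M L" by (intro exI[of _ L]) simp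
  have 5: "\<forall>a b. (a, b) \<in># insert_interval M L \<longrightarrow> b < L + 1 \<longrightarrow> a \<le> L - 1"
    unfolding mem by auto
  have 6: "l = L - 1 \<longleftrightarrow> (\<forall>a b. (a, b) \<in># insert_interval M L \<longrightarrow> L - 1 < b \<longrightarrow> b < L + 1 \<longrightarrow> a = L - 1)"
  proof
    assume "l = L - 1"
    then show "\<forall>a b. (a, b) \<in># insert_interval M L \<longrightarrow> L - 1 < b \<longrightarrow> b < L + 1 \<longrightarrow> a = L - 1"
      unfolding mem by auto
  next
    assume "\<forall>a b. (a, b) \<in># insert_interval M L \<longrightarrow> L - 1 < b \<longrightarrow> b < L + 1 \<longrightarrow> a = L - 1"
    moreover have "(l, L) \<in># insert_interval M L" unfolding mem using assms by simp
    ultimately show "l = L - 1" using assms by simp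
  qed
  show ?thesis unfolding profile_def using 1 2 3 4 5 6 by blast
qed

lemma profile_move3_next:
  assumes "l + 1 < L" "m = l" g
  shows "profile (L + 1) (l + 1) l True (insert_interval M (l + 1))"
proof -
  have l: "l < l + 1" "l + 1 \<le> L" using assms by auto
  note mem = mem_profile_move3[OF l]
  have "min_left_of_max_right M < l + 1" using profile_min_left by simp
  from canonical_move3[OF profile_canonical this l(2)]
  have 1: "canonical (L + 1) (insert_interval M (l + 1))"
    "min_left_of_max_right (insert_interval M (l + 1)) = l + 1" by auto
  have 2: "unnested (insert_interval M (l + 1))" using unnested_profile_move3[OF l] assms by simp
  have "(l, l + 1) \<in># insert_interval M (l + 1)" unfolding mem by simp
  then have 4: "\<exists>b<L + 1. (l, b) \<in># insert_interval M (l + 1)" using assms by (intro exI[of _ "l + 1"]) simp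
  have 5: "\<forall>a b. (a, b) \<in># insert_interval M (l + 1) \<longrightarrow> b < L + 1 \<longrightarrow> a \<le> l"
    unfolding mem by auto
  have 6: "\<forall>a b. (a, b) \<in># insert_interval M (l + 1) \<longrightarrow> l < b \<longrightarrow> b < L + 1 \<longrightarrow> a = l"
  proof (intro allI impI)
    fix a b assume ab: "(a, b) \<in># insert_interval M (l + 1)" "l < b" "b < L + 1"
    then consider "l + 1 < b" "b \<le> L" "(a, b - 1) \<in># M" | "a < l + 1" "l \<le> a" unfolding mem by auto
    then show "a = l"
    proof cases
      case 1
      then have "m < b - 1" "b - 1 < L" using assms by auto
      then show ?thesis using 1(3) assms unfolding profile_flag by blast
    qed simp
  qed
  show ?thesis unfolding profile_def using 1 2 4 5 6 by blast
qed

end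

lemma unnested_move2:
  assumes c: "canonical L M" and un: "unnested M"
  shows "unnested (insert_interval M (L + 1))"
  unfolding unnested_def insert_interval_move2[OF c]
proof (intro allI impI notI)
  fix a b c' d
  assume ab: "(a, b) \<in># add_mset (L + 1, L + 1) M" and cd: "(c', d) \<in># add_mset (L + 1, L + 1) M"
    and nest: "c' < a \<and> b < d"
  have "b \<noteq> L + 1" "c' \<noteq> L + 1" using ab cd nest canonicalD[OF c, of a b] canonicalD[OF c, of c' d] by auto
  then have "(a, b) \<in># M" "(c', d) \<in># M" using ab cd by auto
  then show False using unnestedD[OF un] nest by fastforce
qed

lemma profile_move2:
  assumes c: "canonical L M" and un: "unnested M"
  shows "profile (L + 1) (L + 1) L True (insert_interval M (L + 1))"
proof -
  have mem: "(p, q) \<in># insert_interval M (L + 1) \<longleftrightarrow> p = L + 1 \<and> q = L + 1 \<or> (p, q) \<in># M" for p q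
    unfolding insert_interval_move2[OF c] by auto
  obtain b where "(L, b) \<in># M" "L \<le> b" "b \<le> L" using canonical_left[OF c le_refl] by blast
  then have "(L, b) \<in># insert_interval M (L + 1)" "b < L + 1" using mem by auto
  then have 4: "\<exists>b<L + 1. (L, b) \<in># insert_interval M (L + 1)" by blast
  have 5: "\<forall>a b. (a, b) \<in># insert_interval M (L + 1) \<longrightarrow> b < L + 1 \<longrightarrow> a \<le> L"
    unfolding mem using canonicalD[OF c] by (meson le_trans less_irrefl)
  have 6: "\<forall>a b. (a, b) \<in># insert_interval M (L + 1) \<longrightarrow> L < b \<longrightarrow> b < L + 1 \<longrightarrow> a = L"
    by simp
  show ?thesis unfolding profile_def
    using canonical_move2[OF c] unnested_move2[OF c un] 4 5 6 by blast
qed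

lemma legal_entries_profile:
  assumes p: "profile L l m g M"
  shows "legal_entries M = {i. m \<le> i \<and> i \<le> l} \<union> {L + 1} \<union> {i. l < L \<and> i = L} \<union>
    {i. l + 1 < L \<and> m = l \<and> g \<and> i = l + 1}"
proof (rule set_eqI)
  fix i
  note c = profile_canonical[OF p] and bounds = profile_bounds[OF p]
  have legal: "i \<in> legal_entries M \<longleftrightarrow> i \<le> L + 1 \<and> unnested (insert_interval M i)"
    by (simp add: legal_entries_def max_right_canonical[OF c])
  consider "i \<le> l" | "l < i" "i \<le> L" | "i = L + 1" | "L + 1 < i" by linarith
  then show "i \<in> legal_entries M \<longleftrightarrow> i \<in> {i. m \<le> i \<and> i \<le> l} \<union> {L + 1} \<union> {i. l < L \<and> i = L} \<union>
    {i. l + 1 < L \<and> m = l \<and> g \<and> i = l + 1}"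
  proof cases
    case 1
    then show ?thesis using unnested_profile_move1[OF p 1] bounds legal by auto
  next
    case 2
    then show ?thesis using unnested_profile_move3[OF p 2] bounds legal by auto
  next
    case 3
    then show ?thesis using unnested_move2[OF c profile_unnested[OF p]] legal by simp
  next
    case 4
    then show ?thesis using legal bounds by auto
  qed
qed

section \<open>Counting extensions\<close>

text \<open>The number of ways to append \<open>k\<close> entries to a profile with \<open>d = L - l\<close>, \<open>f \<longleftrightarrow> l = m\<close> and flag \<open>g\<close>. The
  summands belong, in this order, to the entries \<open>l\<close>, \<open>m\<close>, \<open>L + 1\<close>, \<open>L\<close> and \<open>l + 1\<close>.\<close>

fun extension_count :: "nat \<Rightarrow> nat \<Rightarrow> bool \<Rightarrow> bool \<Rightarrow> nat" where
  "extension_count 0 d f g = 1"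
| "extension_count (Suc k) d f g =
     extension_count k d f g +
     (if f then 0 else extension_count k (d + 1) True g) +
     extension_count k 0 False True +
     (if 1 \<le> d then extension_count k 1 False (d = 1) else 0) +
     (if 2 \<le> d \<and> f \<and> g then extension_count k d False True else 0)"

lemma card_extensions_profile:
  "profile L l m g M \<Longrightarrow> card (extensions M k) = extension_count k (L - l) (l = m) g"
proof (induction k arbitrary: L l m g M)
  case 0
  then show ?case by (simp add: extensions_0)
next
  case (Suc k)
  note p = Suc.prems
  note bounds = profile_bounds[OF p] and diff = profile_diff[OF p]
  let ?h = "\<lambda>i. card (extensions (insert_interval M i) k)"
  have stay: "?h l = extension_count k (L - l) (l = m) g"
    using Suc.IH[OF profile_move1[OF p bounds(2) le_refl]] by simp
  have drop: "?h m = extension_count k (L - l + 1) True g" if "l \<noteq> m"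
  proof -
    have "L - l + 1 = L - m" using that diff bounds by linarith
    then show ?thesis using Suc.IH[OF profile_move1[OF p le_refl bounds(2)]] by simp
  qed
  have app: "?h (L + 1) = extension_count k 0 False True"
    using Suc.IH[OF profile_move2[OF profile_canonical[OF p] profile_unnested[OF p]]] by simp
  have last: "?h L = extension_count k 1 False (L - l = 1)" if "l < L"
  proof -
    have "(l = L - 1) = (L - l = 1)" "L \<noteq> L - 1" using that by auto
    then show ?thesis using Suc.IH[OF profile_move3_last[OF p that]] by simp
  qed
  have nxt: "?h (l + 1) = extension_count k (L - l) False True" if "l + 1 < L" "m = l" g
    using Suc.IH[OF profile_move3_next[OF p that]] that by simp
  have A: "{i. m \<le> i \<and> i \<le> l} = (if l = m then {l} else {l, m})" using diff by auto
  have B: "{i. l < L \<and> i = L} = (if l < L then {L} else {})" by auto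
  have C: "{i. l + 1 < L \<and> m = l \<and> g \<and> i = l + 1} = (if l + 1 < L \<and> l = m \<and> g then {l + 1} else {})" by auto
  have "card (extensions M (Suc k)) = ?h l + (if l = m then 0 else ?h m) + ?h (L + 1) +
      (if l < L then ?h L else 0) + (if l + 1 < L \<and> l = m \<and> g then ?h (l + 1) else 0)"
    unfolding card_extensions_Suc legal_entries_profile[OF p] A B C
    using bounds by (cases "l = m"; cases "l < L"; cases "l + 1 < L \<and> l = m \<and> g") auto
  moreover have "1 \<le> L - l \<longleftrightarrow> l < L" "2 \<le> L - l \<longleftrightarrow> l + 1 < L" by auto
  ultimately show ?case using stay drop app last nxt by auto
qed

lemma canonical_zero_unique:
  assumes "canonical 0 M"
  shows "min_left_of_max_right M = 0" "set_mset M = {(0, 0)}"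
proof -
  show "min_left_of_max_right M = 0" using min_left_props(3)[OF assms] by simp
  have "p = (0, 0)" if "p \<in># M" for p
    using canonicalD[OF assms, of "fst p" "snd p"] that by (simp add: prod_eq_iff)
  moreover have "(0, 0) \<in># M" using min_left_props(1)[OF assms] \<open>min_left_of_max_right M = 0\<close> by simp
  ultimately show "set_mset M = {(0, 0)}" by blast
qed

text \<open>The count from the representations with \<open>L = 0\<close>, which have no interval ending before \<open>L\<close> and hence
  no profile. The entry 0 keeps \<open>L = 0\<close>, the entry 1 is a Move 2.\<close>

fun antichain_extension_count :: "nat \<Rightarrow> nat" where
  "antichain_extension_count 0 = 1"
| "antichain_extension_count (Suc k) = antichain_extension_count k + extension_count k 0 False True"

lemma card_extensions_antichain:
  assumes "canonical 0 M"
  shows "card (extensions M k) = antichain_extension_count k"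
  using assms
proof (induction k arbitrary: M)
  case 0
  then show ?case by (simp add: extensions_0)
next
  case (Suc k)
  have un: "unnested M" using canonical_zero_unique(2)[OF Suc.prems] by (simp add: unnested_def)
  have c0: "canonical 0 (insert_interval M 0)" using canonical_move1(1)[OF Suc.prems, of 0] by simp
  have "unnested (insert_interval M 0)" using canonical_zero_unique(2)[OF c0] by (simp add: unnested_def)
  moreover have "unnested (insert_interval M 1)" using unnested_move2[OF Suc.prems un] by simp
  ultimately have "legal_entries M = {0, 1}"
    unfolding legal_entries_def max_right_canonical[OF Suc.prems]
    by (auto simp: le_Suc_eq)
  then show ?case
    using Suc.IH[OF c0] card_extensions_profile[OF profile_move2[OF Suc.prems un], of k]
    by (simp add: card_extensions_Suc)
qed

lemma num_hereditary_Suc: "num_hereditary (Suc k) = antichain_extension_count k"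
  using num_hereditary_eq_card_extensions card_extensions_antichain[OF canonical_zero] by simp

text \<open>For \<open>d \<ge> 2\<close> a step keeps \<open>d\<close>, increases it, or resets it to 0 or 1 in a way independent of \<open>d\<close>.
  So finitely many sequences remain.\<close>

lemma extension_count_far:
  assumes "2 \<le> d"
  shows "extension_count k d f g = extension_count k 2 f g"
  using assms
proof (induction k arbitrary: d f g)
  case (Suc k)
  have "extension_count k (d + 1) True g = extension_count k (2 + 1) True g"
    using Suc.IH[of "d + 1"] Suc.IH[of "2 + 1"] Suc.prems by simp
  moreover have "d \<noteq> 1" "1 \<le> d" using Suc.prems by auto
  ultimately show ?case using Suc.prems by (simp add: Suc.IH[OF Suc.prems])
qed simp

section \<open>The generating function\<close>

text \<open>Linear dependencies among the seven remaining sequences: they hold for \<open>k = 0\<close>, where all counts are 1,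
  and the recursion preserves them. They leave the four sequences of the next lemma.\<close>

lemma extension_count_relations:
  "extension_count k 2 True True = extension_count k 2 False True"
  "extension_count k 1 False False + extension_count k 1 True True =
     extension_count k 0 False True + extension_count k 1 False True"
  "extension_count k 2 True True + extension_count k 1 True True =
     extension_count k 1 False True + extension_count k 2 True False"
proof -
  have far: "extension_count k (Suc (Suc (Suc 0))) True g = extension_count k (Suc (Suc 0)) True g" for k g
    using extension_count_far[of 3 k True g] by (simp add: numeral_2_eq_2 numeral_3_eq_3)
  have "extension_count k 2 True True = extension_count k 2 False True \<and>
    extension_count k 1 False False + extension_count k 1 True True =
     extension_count k 0 False True + extension_count k 1 False True \<and>
    extension_count k 2 True True + extension_count k 1 True True =
     extension_count k 1 False True + extension_count k 2 True False"
  proof (induction k)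
    case (Suc k)
    then show ?case
      by (simp add: far numeral_2_eq_2)
  qed simp
  then show "extension_count k 2 True True = extension_count k 2 False True"
    "extension_count k 1 False False + extension_count k 1 True True =
     extension_count k 0 False True + extension_count k 1 False True"
    "extension_count k 2 True True + extension_count k 1 True True =
     extension_count k 1 False True + extension_count k 2 True False" by blast+
qed

lemma extension_count_Suc_relations:
  "extension_count (Suc k) 0 False True = 2 * extension_count k 0 False True + extension_count k 1 True True"
  "extension_count (Suc k) 1 True True =
     extension_count k 1 True True + extension_count k 0 False True + extension_count k 1 False True"
  "extension_count (Suc k) 1 False True + extension_count k 1 True True =
     3 * extension_count k 1 False True + extension_count k 2 True False + extension_count k 0 False True"
  "extension_count (Suc k) 2 True False + extension_count k 1 True True =
     extension_count k 2 True False + 2 * extension_count k 0 False True + extension_count k 1 False True"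
  using extension_count_relations[of k] by (simp_all add: numeral_2_eq_2)

abbreviation gf :: "(nat \<Rightarrow> nat) \<Rightarrow> rat fps" where
  "gf c \<equiv> Abs_fps (\<lambda>k. of_nat (c k))"

theorem theorem4p1:
  shows "Abs_fps (\<lambda>n. if n \<ge> 1 then of_nat (num_hereditary n) else 0 :: rat) =
    (- (fps_X ^ 5) + 9 * fps_X ^ 4 - 12 * fps_X ^ 3 + 6 * fps_X ^ 2 - fps_X) /
    (fps_X ^ 5 - 14 * fps_X ^ 4 + 29 * fps_X ^ 3 - 23 * fps_X ^ 2 + 8 * fps_X - 1)"
    (is "?H = ?num / ?den")
proof -
  let ?X = "fps_X :: rat fps"
  define u where "u = gf antichain_extension_count"
  define z where "z = gf (\<lambda>k. extension_count k 0 False True)"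
  define a where "a = gf (\<lambda>k. extension_count k 1 True True)"
  define w where "w = gf (\<lambda>k. extension_count k 1 False True)"
  define n where "n = gf (\<lambda>k. extension_count k 2 True False)"
  have rel: "rat_of_nat (extension_count (Suc k) 0 False True) =
      2 * of_nat (extension_count k 0 False True) + of_nat (extension_count k 1 True True)"
    "rat_of_nat (extension_count (Suc k) 1 True True) =
     of_nat (extension_count k 1 True True) + of_nat (extension_count k 0 False True) + of_nat (extension_count k 1 False True)"
    "rat_of_nat (extension_count (Suc k) 1 False True) = 3 * of_nat (extension_count k 1 False True)
      + of_nat (extension_count k 2 True False) + of_nat (extension_count k 0 False True)
      - of_nat (extension_count k 1 True True)"
    "rat_of_nat (extension_count (Suc k) 2 True False) = of_nat (extension_count k 2 True False)
      + 2 * of_nat (extension_count k 0 False True) + of_nat (extension_count k 1 False True)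
      - of_nat (extension_count k 1 True True)" for k
    using extension_count_Suc_relations[of k, THEN arg_cong[of _ _ rat_of_nat]]
    unfolding of_nat_add of_nat_mult of_nat_numeral by (simp_all only: eq_diff_eq)
  have u: "u = 1 + ?X * (u + z)"
  proof (rule fps_ext)
    fix k show "fps_nth u k = fps_nth (1 + ?X * (u + z)) k" by (cases k) (simp_all add: u_def z_def)
  qed
  have z: "z = 1 + ?X * (z + z + a)"
  proof (rule fps_ext)
    fix k show "fps_nth z k = fps_nth (1 + ?X * (z + z + a)) k"
      by (cases k) (simp_all add: z_def a_def rel numeral_fps_const del: One_nat_def extension_count.simps(2))
  qed
  have a: "a = 1 + ?X * (a + z + w)"
  proof (rule fps_ext)
    fix k show "fps_nth a k = fps_nth (1 + ?X * (a + z + w)) k"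
      by (cases k) (simp_all add: z_def a_def w_def rel numeral_fps_const del: One_nat_def extension_count.simps(2))
  qed
  have w: "w = 1 + ?X * (w + w + w + n + z - a)"
  proof (rule fps_ext)
    fix k show "fps_nth w k = fps_nth (1 + ?X * (w + w + w + n + z - a)) k"
      by (cases k) (simp_all add: z_def a_def w_def n_def rel numeral_fps_const del: One_nat_def extension_count.simps(2))
  qed
  have n: "n = 1 + ?X * (n + z + z + w - a)"
  proof (rule fps_ext)
    fix k show "fps_nth n k = fps_nth (1 + ?X * (n + z + z + w - a)) k"
      by (cases k) (simp_all add: z_def a_def w_def n_def rel numeral_fps_const del: One_nat_def extension_count.simps(2))
  qed
  have H: "?H = ?X * u"
  proof (rule fps_ext)
    fix k show "fps_nth ?H k = fps_nth (?X * u) k"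
      by (cases k) (simp_all add: u_def num_hereditary_Suc)
  qed
  \<comment> \<open>Each of the equations for \<open>z\<close>, \<open>a\<close> and \<open>w\<close> expresses the next unknown by the earlier ones;
    the equation for \<open>n\<close> then determines \<open>z\<close>.\<close>
  have Pz: "(1 - 7 * ?X + 16 * ?X ^ 2 - 13 * ?X ^ 3 + ?X ^ 4) * z = 1 - 4 * ?X + 4 * ?X ^ 2"
    using z a w n by algebra
  \<comment> \<open>The denominator is \<open>- (1 - X)\<close> times the quartic polynomial, and \<open>(1 - X) * u = 1 + X * z\<close>.\<close>
  have "?X * u * ?den = ?num" using u Pz by algebra
  moreover have "?den \<noteq> 0"
  proof
    assume "?den = 0"
    then have "fps_nth ?den 0 = 0" by simp
    then show False by simp
  qed
  ultimately show ?thesis unfolding H by (metis nonzero_mult_div_cancel_right)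
qed

end
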